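(* Let $k\ge1$. For all $t_1,t_2\in\mathrm{SOP}[\frac1{2^{k+1}}]'$, $[\![t_1]\!]=[\![t_2]\!]$ if and only if $t_1\sim_{\mathrm{TH}}t_2$.
   Context: An SOP morphism $t:n\to m$ is a formal expression $t=s\sum_{\vec y\in V^k}e^{2i\pi P(\vec y)}|\vec O(\vec y)\rangle\langle\vec I(\vec y)|$ where $s\in\mathbb R$, $\vec y$ are distinct boolean summation variables, $P\in\mathbb R[\vec y]/(y_j^2-y_j)$, $\vec O\in\mathbb F_2[\vec y]^m$, $\vec I\in\mathbb F_2[\vec y]^n$; morphisms are identified up to renaming variables and phase polynomials modulo integer-coefficient polynomials. Interpretation: $[\![t]\!]=s\sum_{\vec y\in\{0,1\}^k}e^{2i\pi P(\vec y)}|\vec O(\vec y)\rangle\langle\vec I(\vec y)|$. $\mathrm{SOP}[\frac1{2^n}]'$ is the set of morphisms $\frac1{2^p}\sum_{\vec y}e^{2i\pi\frac{P}{2^n}}|\vec O\rangle\langle\vec I|$ with $p\in\mathbb Z$ and $P$ with integer coefficients. For $Q\in\mathbb F_2[\vec y]$, $\widehat Q$ is defined by $\widehat{Q_1Q_2}=\widehat{Q_1}\widehat{Q_2}$, $\widehat{Q_1\oplus Q_2}=\widehat{Q_1}+\widehat{Q_2}-2\widehat{Q_1}\widehat{Q_2}$, $\widehat{y_j}=y_j$, $\widehat0=0,\widehat1=1$. Rewriting: $\mathrm{Var}(\cdot)$ is the set of variables in a collection of polynomials; $t[y\leftarrow Q]$ substitutes $Q$ for $y$ in $\vec O,\vec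 I$ and $\widehat Q$ in $P$. $\to_{\mathrm{TH}}$ consists of the rules (applied to whole morphisms, scalar $s$ carried along unless stated): (Elim) $s\sum_{\vec y}e^{2i\pi P}|\vec O\rangle\langle\vec I|\to 2s\sum_{\vec y\setminus\{y_0\}}e^{2i\pi P}|\vec O\rangle\langle\vec I|$ if $y_0\notin\mathrm{Var}(P,\vec O,\vec I)$; (HHgen) $t=s\sum_{\vec y}e^{2i\pi(\frac{y_0}{2}(y_i\widehat Q+\widehat{Q'}+1)+R)}|\vec O\rangle\langle\vec I|\to t[y_i\leftarrow1\oplus Q']$ with $y_i$ removed from the summation, provided $y_0\ne y_i$, $QQ'=Q'$, $y_0\notin\mathrm{Var}(Q,Q',R,\vec O,\vec I)$, $y_i\notin\mathrm{Var}(Q,Q')$; (ket) if $O_i=y_0\oplus O_i'$, $O_i'\ne0$, $y_0\notin\mathrm{Var}(O_1,\dots,O_{i-1},O_i')$ then $t\to t[y_0\leftarrow O_i]$; (bra) if $I_i=y_0\oplus I_i'$, $I_i'\ne0$, $y_0\notin\mathrm{Var}(\vec O,I_1,\dots,I_{i-1},I_i')$ then $t\to t[y_0\leftarrow I_i]$; (Z) $s\sum_{\vec y}e^{2i\pi(\frac{y_0}{2}+R)}|\vec O\rangle\langle\vec I|\to\sum_{y_0}e^{2i\pi\frac{y_0}2}|0\cdots0\rangle\langle0\cdots0|$ if $y_0\notin\mathrm{Var}(R,\vec O,\vec I)$ and ($R\ne0$ or $\vec O,\vec I$ not all zero). $\sim_{\mathrm{TH}}$ is the equivalence relation generated by $\to_{\mathrm{TH}}$.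 *)

theory Defs
  imports Complex_Main "HOL-Library.Poly_Mapping" "HOL-Library.Z2" "HOL-Library.FuncSet"
begin

section \<open>Polynomials in idempotent variables\<close>

text \<open>
  A monomial modulo \<open>y\<^sub>j\<^sup>2 = y\<^sub>j\<close> is a finite set of variables, and multiplying monomials is
  taking the union. With this monoid structure on \<open>smon\<close>, the library ring \<open>smon \<Rightarrow>\<^sub>0 'a\<close>
  (its product is the convolution) is the quotient of the polynomial ring over \<open>'a\<close> in
  variables indexed by \<open>nat\<close> by the ideal of all \<open>y\<^sub>j\<^sup>2 - y\<^sub>j\<close>. It is used with
  \<open>'a = real\<close> for phase polynomials and with \<open>'a = bit\<close>, the two-element field, for Boolean
  polynomials.
\<close>

typedef smon = "{A :: nat set. finite A}" morphisms vars_of Mon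
  by blast

setup_lifting type_definition_smon

instantiation smon :: comm_monoid_add
begin

lift_definition zero_smon :: smon is "{}" by simp

lift_definition plus_smon :: "smon \<Rightarrow> smon \<Rightarrow> smon" is "(\<union>)" by simp

instance by standard (transfer; auto)+

end

lemma smon_idem [simp]: "m + m = (m :: smon)"
  by transfer simp

type_synonym 'a bpoly = "smon \<Rightarrow>\<^sub>0 'a"

definition Const :: "'a::zero \<Rightarrow> 'a bpoly" where
  "Const c = Poly_Mapping.single 0 c"

definition Vr :: "nat \<Rightarrow> 'a::zero_neq_one bpoly" where
  "Vr y = Poly_Mapping.single (Mon {y}) 1"

definition Var :: "'a::zero bpoly \<Rightarrow> nat set" where
  "Var p = (\<Union>m \<in> Poly_Mapping.keys p. vars_of m)"

definition peval :: "(nat \<Rightarrow> 'a) \<Rightarrow> 'a::comm_ring_1 bpoly \<Rightarrow> 'a" where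
  "peval \<sigma> p = (\<Sum>m \<in> Poly_Mapping.keys p. Poly_Mapping.lookup p m * (\<Prod>v \<in> vars_of m. \<sigma> v))"

definition psubst :: "(nat \<Rightarrow> 'a bpoly) \<Rightarrow> 'a::comm_ring_1 bpoly \<Rightarrow> 'a bpoly" where
  "psubst f p = (\<Sum>m \<in> Poly_Mapping.keys p.
     Const (Poly_Mapping.lookup p m) * (\<Prod>v \<in> vars_of m. f v))"

definition psubst1 :: "nat \<Rightarrow> 'a bpoly \<Rightarrow> 'a::comm_ring_1 bpoly \<Rightarrow> 'a bpoly" where
  "psubst1 y q = psubst (Vr(y := q))"

definition rename :: "(nat \<Rightarrow> nat) \<Rightarrow> 'a::comm_ring_1 bpoly \<Rightarrow> 'a bpoly" where
  "rename f = psubst (\<lambda>v. Vr (f v))"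

definition int_coeffs :: "real bpoly \<Rightarrow> bool" where
  "int_coeffs p \<longleftrightarrow> (\<forall>m. Poly_Mapping.lookup p m \<in> \<int>)"


section \<open>The lifting of Boolean polynomials to real polynomials\<close>

text \<open>
  The defining equations of the lifting are \<open>hat_0\<close>, \<open>hat_1\<close>, \<open>hat_Vr\<close>, \<open>hat_mult\<close> and
  \<open>hat_add\<close> below, and \<open>hat_unique\<close> shows that they determine it. The closed form used as the
  definition comes from \<open>1 - 2(a + b - 2ab) = (1 - 2a)(1 - 2b)\<close>.
\<close>

definition hat :: "bit bpoly \<Rightarrow> real bpoly" where
  "hat Q = Const (1/2) * (1 - (\<Prod>m \<in> Poly_Mapping.keys Q. 1 - 2 * Poly_Mapping.single m 1))"

lemma Const_half: "Const (1/2 :: real) * 2 = 1"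
proof -
  have "(2 :: real bpoly) = Const 2"
    by (metis Const_def single_numeral)
  then have "Const (1/2 :: real) * 2 = Const (1/2) * Const 2"
    by (simp only:)
  also have "\<dots> = 1"
    unfolding Const_def mult_single by simp
  finally show ?thesis .
qed

lemma hat_sign:
  "1 - 2 * hat Q = (\<Prod>m \<in> Poly_Mapping.keys Q. 1 - 2 * Poly_Mapping.single m (1::real))"
proof -
  have "2 * hat Q = (Const (1/2) * 2) *
      (1 - (\<Prod>m \<in> Poly_Mapping.keys Q. 1 - 2 * Poly_Mapping.single m (1::real)))"
    unfolding hat_def by (simp only: mult_ac)
  then show ?thesis by (simp add: Const_half)
qed

lemma double_cancel:
  assumes "2 * p = 2 * (q :: real bpoly)" shows "p = q"
proof -
  have "(Const (1/2) * 2) * p = (Const (1/2) * 2) * q"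
    using assms by (simp only: mult.assoc)
  then show ?thesis by (simp add: Const_half)
qed

lemma hat_0 [simp]: "hat 0 = 0"
  by (simp add: hat_def)

lemma hat_single [simp]: "hat (Poly_Mapping.single m 1) = Poly_Mapping.single m 1"
  by (rule double_cancel) (use hat_sign[of "Poly_Mapping.single m 1"] in simp)

lemma hat_1 [simp]: "hat 1 = 1"
  by (metis hat_single single_one)

lemma hat_Vr [simp]: "hat (Vr y) = Vr y"
  by (simp add: Vr_def)

lemma hat_add: "hat (Q1 + Q2) = hat Q1 + hat Q2 - 2 * hat Q1 * hat Q2"
proof -
  let ?f = "\<lambda>m :: smon. 1 - 2 * Poly_Mapping.single m (1::real)"
  let ?A = "Poly_Mapping.keys Q1" and ?B = "Poly_Mapping.keys Q2"
  have sq: "?f m * ?f m = 1" for m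
  proof -
    have "(1 - 2 * a) * (1 - 2 * a) = 1 - 4 * a + 4 * (a * a)" for a :: "real bpoly"
      by (simp add: algebra_simps)
    from this[of "Poly_Mapping.single m 1"] show ?thesis
      unfolding mult_single by simp
  qed
  have keys: "Poly_Mapping.keys (Q1 + Q2) = (?A - ?B) \<union> (?B - ?A)"
    by (auto simp: in_keys_iff lookup_add)
  have AB: "prod ?f ?A = prod ?f (?A - ?B) * prod ?f (?A \<inter> ?B)"
    by (subst prod.Int_Diff[where B = ?B]) (simp_all only: finite_keys mult.commute)
  have BA: "prod ?f ?B = prod ?f (?B - ?A) * prod ?f (?A \<inter> ?B)"
    by (subst prod.Int_Diff[where B = ?A]) (simp_all only: finite_keys mult.commute Int_commute)
  have one: "prod ?f (?A \<inter> ?B) * prod ?f (?A \<inter> ?B) = 1"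
    unfolding prod.distrib[symmetric] sq by simp
  have "prod ?f ?A * prod ?f ?B =
      prod ?f (?A - ?B) * prod ?f (?B - ?A) * (prod ?f (?A \<inter> ?B) * prod ?f (?A \<inter> ?B))"
    unfolding AB BA by (simp only: mult_ac)
  also have "\<dots> = prod ?f (Poly_Mapping.keys (Q1 + Q2))"
    unfolding one keys by (subst prod.union_disjoint) auto
  finally have "1 - 2 * hat (Q1 + Q2) = (1 - 2 * hat Q1) * (1 - 2 * hat Q2)"
    by (simp only: hat_sign)
  then have "2 * hat (Q1 + Q2) = 2 * (hat Q1 + hat Q2 - 2 * hat Q1 * hat Q2)"
    by (simp add: algebra_simps)
  then show ?thesis by (rule double_cancel)
qed

lemma bit_bpoly_induct [case_names zero add]:
  assumes "P 0" and "\<And>m Q. P Q \<Longrightarrow> P (Poly_Mapping.single m 1 + Q)"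
  shows "P (Q :: bit bpoly)"
proof -
  have "P (\<Sum>m \<in> A. Poly_Mapping.single m 1)" if "finite A" for A
    using that by (induction A rule: finite_induct) (auto intro: assms)
  moreover have "Q = (\<Sum>m \<in> Poly_Mapping.keys Q. Poly_Mapping.single m 1)"
    by (rule poly_mapping_eqI) (auto simp: lookup_sum lookup_single when_def in_keys_iff)
  ultimately show ?thesis by (metis finite_keys)
qed

lemma hat_idem: "hat Q * hat Q = hat Q"
proof (induction Q rule: bit_bpoly_induct)
  case (add m Q)
  define a b where "a = Poly_Mapping.single m (1::real)" and "b = hat Q"
  have a: "a * a = a" and b: "b * b = b"
    using add by (simp_all add: a_def b_def mult_single)
  have "(a + b - 2 * a * b) * (a + b - 2 * a * b) =
      a * a + b * b + 2 * a * b - 4 * (a * a) * b - 4 * a * (b * b) + 4 * (a * a) * (b * b)"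
    by (simp add: algebra_simps)
  also have "\<dots> = a + b - 2 * a * b" unfolding a b by (simp add: algebra_simps)
  finally show ?case by (simp add: hat_add a_def b_def)
qed simp

lemma hat_mult_single:
  "hat (Poly_Mapping.single m 1 * Q) = Poly_Mapping.single m 1 * hat Q"
proof (induction Q rule: bit_bpoly_induct)
  case (add m' Q)
  define a b c where "a = Poly_Mapping.single m (1::real)" and "b = Poly_Mapping.single m' (1::real)"
    and "c = hat Q"
  have a: "a * a = a" by (simp add: a_def mult_single)
  have "hat (Poly_Mapping.single m 1 * Poly_Mapping.single m' 1) = a * b"
    by (simp add: mult_single a_def b_def)
  then have "hat (Poly_Mapping.single m 1 * (Poly_Mapping.single m' 1 + Q)) =
      a * b + a * c - 2 * (a * a) * b * c"
    unfolding distrib_left hat_add add by (simp add: a_def c_def mult_ac)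
  also have "\<dots> = a * (b + c - 2 * b * c)"
    unfolding a by (simp add: algebra_simps)
  finally show ?case by (simp add: hat_add a_def b_def c_def)
qed simp

lemma hat_mult: "hat (Q1 * Q2) = hat Q1 * hat Q2"
proof (induction Q1 rule: bit_bpoly_induct)
  case (add m Q)
  define a b c where "a = Poly_Mapping.single m (1::real)" and "b = hat Q" and "c = hat Q2"
  have c: "c * c = c" by (simp add: c_def hat_idem)
  have "hat ((Poly_Mapping.single m 1 + Q) * Q2) = a * c + b * c - 2 * a * b * (c * c)"
    unfolding distrib_right hat_add hat_mult_single add
    by (simp add: a_def b_def c_def mult_ac)
  also have "\<dots> = (a + b - 2 * a * b) * c"
    unfolding c by (simp add: algebra_simps)
  finally show ?case by (simp add: hat_add a_def b_def c_def)
qed simp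

lemma hat_unique:
  assumes "h 0 = 0" and "h 1 = 1" and "\<And>y. h (Vr y) = Vr y"
    and "\<And>Q1 Q2. h (Q1 * Q2) = h Q1 * h Q2"
    and "\<And>Q1 Q2. h (Q1 + Q2) = h Q1 + h Q2 - 2 * h Q1 * h Q2"
  shows "h = hat"
proof
  have *: "h (Poly_Mapping.single (Mon A) 1) = Poly_Mapping.single (Mon A) 1"
    if "finite A" for A
    using that
  proof (induction A rule: finite_induct)
    case empty
    have "Mon {} = 0" by (simp add: zero_smon_def)
    then show ?case using assms(2) by simp
  next
    case (insert v A)
    have "Mon (insert v A) = Mon {v} + Mon A"
      using insert by (simp add: plus_smon.abs_eq eq_onp_def)
    then have eq: "Poly_Mapping.single (Mon (insert v A)) 1 =
        Vr v * Poly_Mapping.single (Mon A) (1 :: 'x :: comm_ring_1)"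
      by (simp add: Vr_def mult_single)
    show ?case unfolding eq by (simp add: assms insert)
  qed
  fix Q show "h Q = hat Q"
  proof (induction Q rule: bit_bpoly_induct)
    case (add m Q)
    obtain A where "m = Mon A" "finite A" by (metis mem_Collect_eq Mon_cases)
    with add show ?case by (simp add: assms(5) hat_add *)
  qed (use assms in simp)
qed


section \<open>Sum-over-paths morphisms\<close>

text \<open>
  A record represents
  \<open>scal \<cdot> \<Sum>svars. e\<^bsup>2i\<pi> phase\<^esup> |outs\<rangle>\<langle>ins|\<close>. Records are representatives: morphisms are
  records up to \<open>sop_ident\<close>.
\<close>

record sop =
  scal :: real
  svars :: "nat set"
  phase :: "real bpoly"
  outs :: "bit bpoly list"
  ins :: "bit bpoly list"

definition SOP :: "nat \<Rightarrow> nat \<Rightarrow> sop set" where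
  "SOP n m = {t. finite (svars t) \<and> Var (phase t) \<subseteq> svars t
     \<and> length (outs t) = m \<and> (\<forall>q \<in> set (outs t). Var q \<subseteq> svars t)
     \<and> length (ins t) = n \<and> (\<forall>q \<in> set (ins t). Var q \<subseteq> svars t)}"

definition sop_ident :: "sop \<Rightarrow> sop \<Rightarrow> bool" where
  "sop_ident t t' \<longleftrightarrow> (\<exists>f. bij_betw f (svars t) (svars t')
     \<and> scal t' = scal t
     \<and> int_coeffs (phase t' - rename f (phase t))
     \<and> outs t' = map (rename f) (outs t)
     \<and> ins t' = map (rename f) (ins t))"

text \<open>Linear maps from \<open>n\<close> to \<open>m\<close> qubits are matrices whose rows and columns are indexed by
  bit strings of length \<open>m\<close> and \<open>n\<close> (with value \<open>0\<close> at indices of other lengths).\<close>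

definition ket_bra :: "bit list \<Rightarrow> bit list \<Rightarrow> bit list \<Rightarrow> bit list \<Rightarrow> complex" where
  "ket_bra u v = (\<lambda>x x'. of_bool (x = u \<and> x' = v))"

definition interp :: "sop \<Rightarrow> bit list \<Rightarrow> bit list \<Rightarrow> complex" where
  "interp t = (\<lambda>x x'. complex_of_real (scal t) *
     (\<Sum>\<sigma> \<in> svars t \<rightarrow>\<^sub>E (UNIV :: bit set).
        exp (2 * \<i> * complex_of_real pi * complex_of_real (peval (\<lambda>v. of_bit (\<sigma> v)) (phase t)))
        * ket_bra (map (peval \<sigma>) (outs t)) (map (peval \<sigma>) (ins t)) x x'))"

text \<open>The dyadic fragment: phases in \<open>1/2\<^sup>d\<close> times integer polynomials and scalars in \<open>2\<^sup>\<int>\<close>.\<close>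

definition dyadic_SOP :: "nat \<Rightarrow> nat \<Rightarrow> nat \<Rightarrow> sop set" where
  "dyadic_SOP d n m = {t \<in> SOP n m. (\<exists>p :: int. scal t = 1 / 2 powi p)
     \<and> (\<exists>P. int_coeffs P \<and> phase t = Const (1 / 2 ^ d) * P)}"


section \<open>The rewrite system\<close>

definition sop_subst :: "nat \<Rightarrow> bit bpoly \<Rightarrow> sop \<Rightarrow> sop" where
  "sop_subst y Q t = t\<lparr>phase := psubst1 y (hat Q) (phase t),
     outs := map (psubst1 y Q) (outs t), ins := map (psubst1 y Q) (ins t)\<rparr>"

abbreviation Vars :: "'a::zero bpoly list \<Rightarrow> nat set" where
  "Vars qs \<equiv> (\<Union>q \<in> set qs. Var q)"

text \<open>The rules act on representatives, so a phase pattern or the condition \<open>y\<^sub>0 \<notin> Var P\<close> may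
  be met by any representative; \<open>R \<noteq> 0\<close> in rule \<open>Z\<close> has to be read modulo integer polynomials.\<close>

inductive TH_step :: "sop \<Rightarrow> sop \<Rightarrow> bool" where
  Elim:
    "\<lbrakk> y0 \<in> svars t; y0 \<notin> Var (phase t) \<union> Vars (outs t) \<union> Vars (ins t) \<rbrakk>
     \<Longrightarrow> TH_step t (t\<lparr>scal := 2 * scal t, svars := svars t - {y0}\<rparr>)"
| HHgen:
    "\<lbrakk> y0 \<in> svars t; yi \<in> svars t; y0 \<noteq> yi;
       phase t = Const (1/2) * Vr y0 * (Vr yi * hat Q + hat Q' + 1) + R;
       Q * Q' = Q';
       y0 \<notin> Var Q \<union> Var Q' \<union> Var R \<union> Vars (outs t) \<union> Vars (ins t);
       yi \<notin> Var Q \<union> Var Q' \<rbrakk>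
     \<Longrightarrow> TH_step t ((sop_subst yi (1 + Q') t)\<lparr>svars := svars t - {yi}\<rparr>)"
| ket:
    "\<lbrakk> y0 \<in> svars t; i < length (outs t); outs t ! i = Vr y0 + O'; O' \<noteq> 0;
       y0 \<notin> Vars (take i (outs t)) \<union> Var O' \<rbrakk>
     \<Longrightarrow> TH_step t (sop_subst y0 (outs t ! i) t)"
| bra:
    "\<lbrakk> y0 \<in> svars t; i < length (ins t); ins t ! i = Vr y0 + I'; I' \<noteq> 0;
       y0 \<notin> Vars (outs t) \<union> Vars (take i (ins t)) \<union> Var I' \<rbrakk>
     \<Longrightarrow> TH_step t (sop_subst y0 (ins t ! i) t)"
| Z:
    "\<lbrakk> y0 \<in> svars t; phase t = Const (1/2) * Vr y0 + R;
       y0 \<notin> Var R \<union> Vars (outs t) \<union> Vars (ins t);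
       \<not> int_coeffs R \<or> (\<exists>q \<in> set (outs t @ ins t). q \<noteq> 0) \<rbrakk>
     \<Longrightarrow> TH_step t \<lparr>scal = 1, svars = {y0}, phase = Const (1/2) * Vr y0,
           outs = replicate (length (outs t)) 0, ins = replicate (length (ins t)) 0\<rparr>"

text \<open>The generated equivalence relation on morphisms \<open>n \<rightarrow> m\<close>; including \<open>sop_ident\<close> among the
  generators accounts for records being representatives only.\<close>

definition TH_equiv :: "nat \<Rightarrow> nat \<Rightarrow> sop \<Rightarrow> sop \<Rightarrow> bool" where
  "TH_equiv n m = equivclp (\<lambda>t t'. t \<in> SOP n m \<and> t' \<in> SOP n m \<and> (sop_ident t t' \<or> TH_step t t'))"

end

theory Submission
  imports Defs "HOL-Library.Multiset" "HOL-Combinatorics.Permutations"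
    "HOL-Analysis.Complex_Transcendental" "HOL-Computational_Algebra.Polynomial_Factorial"
begin

text \<open>
  A morphism with \<open>k\<close> summation variables is a scalar together with \<open>2\<^sup>k\<close> paths, a path being a
  phase with an output and an input bit string. Introducing a variable by a backward \<open>HH\<close> step and
  solving its constraint for another variable gives the substitution \<open>y \<leftarrow> y \<oplus> g\<close> for every \<open>g\<close> not
  containing \<open>y\<close>. Taking for \<open>g\<close> the indicator of a point, this swaps two adjacent assignments, and such
  swaps generate all permutations of the assignments: only the multiset of paths matters.

  Write \<open>-e\<close> for the path \<open>e\<close> with opposite phase. On multisets, \<open>Elim\<close> relates \<open>(s, M + M)\<close> to \<open>(2s, M)\<close>,
  and \<open>HHgen\<close> with \<open>Q' = 0\<close> removes the pairs \<open>B + -B\<close> from \<open>C + C + (A + -A) + (B + -B)\<close> if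
  \<open>|C| + |A| = |B|\<close>. This suffices to exchange the cancelling pairs in \<open>N + (E + -E)\<close> for any others.
  For phases that are \<open>2\<^sup>d\<close>-th roots of unity, the interpretation determines the part \<open>N\<close> without
  cancelling pairs, since \<open>\<omega> \<mapsto> -\<omega>\<close> accounts for all integer relations among these roots.
\<close>

section \<open>Evaluation of polynomials in idempotent variables\<close>

lemma finite_vars_of [simp]: "finite (vars_of m)"
  using vars_of[of m] by simp

lemma vars_of_add [simp]: "vars_of (m + m') = vars_of m \<union> vars_of m'"
  by (rule plus_smon.rep_eq)

lemma vars_of_zero [simp]: "vars_of 0 = {}"
  by (rule zero_smon.rep_eq)

lemma vars_of_Mon [simp]: "finite A \<Longrightarrow> vars_of (Mon A) = A"
  by (simp add: Mon_inverse)

lemma bpoly_induct [case_names zero add]: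
  fixes p :: "'a::comm_ring_1 bpoly"
  assumes "P 0" and "\<And>m c q. P q \<Longrightarrow> P (Poly_Mapping.single m c + q)"
  shows "P p"
proof -
  have "P (\<Sum>m \<in> A. Poly_Mapping.single m (Poly_Mapping.lookup p m))" if "finite A" for A
    using that by (induction A rule: finite_induct) (auto intro: assms)
  moreover have "p = (\<Sum>m \<in> Poly_Mapping.keys p. Poly_Mapping.single m (Poly_Mapping.lookup p m))"
    by (rule poly_mapping_eqI) (auto simp: lookup_sum lookup_single when_def in_keys_iff)
  ultimately show ?thesis by (metis finite_keys)
qed

lemma peval_superset:
  assumes "finite S" "Poly_Mapping.keys p \<subseteq> S"
  shows "peval \<sigma> p = (\<Sum>m \<in> S. Poly_Mapping.lookup p m * (\<Prod>v \<in> vars_of m. \<sigma> v))"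
  unfolding peval_def using assms
  by (intro sum.mono_neutral_left) (auto simp: in_keys_iff)

lemma peval_zero [simp]: "peval \<sigma> 0 = 0"
  by (simp add: peval_def)

lemma peval_add [simp]: "peval \<sigma> (p + q) = peval \<sigma> p + peval \<sigma> q"
proof -
  let ?S = "Poly_Mapping.keys p \<union> Poly_Mapping.keys q"
  have "Poly_Mapping.keys (p + q) \<subseteq> ?S" by (rule Poly_Mapping.keys_add)
  then show ?thesis
    by (simp add: peval_superset[of ?S] lookup_add distrib_right sum.distrib)
qed

lemma peval_uminus [simp]: "peval \<sigma> (- p) = - peval \<sigma> p"
  using peval_add[of \<sigma> "- p" p] by (simp add: eq_neg_iff_add_eq_0 del: peval_add)

lemma peval_diff [simp]: "peval \<sigma> (p - q) = peval \<sigma> p - peval \<sigma> q"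
  using peval_add[of \<sigma> p "- q"] by simp

lemma peval_single [simp]:
  "peval \<sigma> (Poly_Mapping.single m c) = c * (\<Prod>v \<in> vars_of m. \<sigma> v)"
  by (simp add: peval_def)

lemma peval_Const [simp]: "peval \<sigma> (Const c) = c"
  by (simp add: Const_def)

lemma peval_one [simp]: "peval \<sigma> 1 = 1"
  by (metis Const_def peval_Const single_one)

lemma peval_Vr [simp]: "peval \<sigma> (Vr y) = \<sigma> y"
  by (simp add: Vr_def)

lemma peval_sum: "peval \<sigma> (sum f A) = (\<Sum>x\<in>A. peval \<sigma> (f x))"
  by (induction A rule: infinite_finite_induct) auto

text \<open>A factor shared by both index sets is counted once on the left and twice on the right;
  idempotence makes the repetition harmless. This is what multiplying monomials by union requires of
  an evaluation.\<close>

lemma prod_union_idem: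
  fixes f :: "'b \<Rightarrow> 'a::comm_monoid_mult"
  assumes "finite A" "finite B" and idem: "\<And>v. f v * f v = f v"
  shows "prod f (A \<union> B) = prod f A * prod f B"
  using assms(1)
proof (induction A rule: finite_induct)
  case (insert x A)
  show ?case
  proof (cases "x \<in> B")
    case True
    then have "prod f B = f x * prod f (B - {x})"
      using assms(2) by (simp add: prod.remove)
    then have "f x * prod f B = prod f B"
      by (simp only: mult.assoc[symmetric] idem)
    then have "f x * prod f A * prod f B = prod f A * prod f B"
      by (simp only: mult.assoc mult.left_commute[of "f x" "prod f A"])
    moreover have "insert x A \<union> B = A \<union> B" using True by auto
    ultimately show ?thesis using insert by simp
  qed (use insert assms(2) in \<open>simp add: mult_ac\<close>)
qed simp

text \<open>Modulo \<open>y * y = y\<close>, evaluation is a ring homomorphism only at points with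
  idempotent coordinates. Both kinds of points evaluated below are of this sort: all points over
  \<open>bit\<close>, and 0/1 points over the reals.\<close>

lemma peval_mult:
  assumes idem: "\<And>v. \<sigma> v * \<sigma> v = \<sigma> v"
  shows "peval \<sigma> (p * q) = peval \<sigma> p * peval \<sigma> q"
proof -
  have single: "peval \<sigma> (Poly_Mapping.single m c * q) = peval \<sigma> (Poly_Mapping.single m c) * peval \<sigma> q"
    for m c and q :: "'a bpoly"
    by (induction q rule: bpoly_induct)
      (simp_all add: distrib_left mult_single prod_union_idem idem mult_ac)
  show ?thesis
    by (induction p rule: bpoly_induct) (simp_all add: distrib_right single del: peval_single)
qed

lemma peval_prod:
  assumes "\<And>v. \<sigma> v * \<sigma> v = \<sigma> v"
  shows "peval \<sigma> (prod f A) = (\<Prod>x\<in>A. peval \<sigma> (f x))"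
  by (induction A rule: infinite_finite_induct) (auto simp: peval_mult assms)

lemma peval_psubst:
  assumes "\<And>v. \<sigma> v * \<sigma> v = \<sigma> v"
  shows "peval \<sigma> (psubst f p) = peval (\<lambda>v. peval \<sigma> (f v)) p"
  unfolding psubst_def by (simp add: peval_sum peval_mult peval_prod assms) (simp add: peval_def)

lemma peval_cong:
  assumes "\<And>v. v \<in> Var p \<Longrightarrow> \<sigma> v = \<tau> v"
  shows "peval \<sigma> p = peval \<tau> p"
  unfolding peval_def using assms by (intro sum.cong arg_cong2[where f = "(*)"] prod.cong) (auto simp: Var_def)

lemma peval_psubst1:
  assumes "\<And>v. \<sigma> v * \<sigma> v = \<sigma> v"
  shows "peval \<sigma> (psubst1 y q p) = peval (\<sigma>(y := peval \<sigma> q)) p"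
  unfolding psubst1_def peval_psubst[OF assms] by (rule peval_cong) auto

lemma peval_rename:
  assumes "\<And>v. \<sigma> v * \<sigma> v = \<sigma> v"
  shows "peval \<sigma> (rename f p) = peval (\<lambda>v. \<sigma> (f v)) p"
  unfolding rename_def peval_psubst[OF assms] by simp

lemma bit_idem: "b * b = (b :: bit)"
  by (cases b) auto

text \<open>One name for 0/1 points in every coefficient ring. For \<open>bit\<close> it is the
  identity (\<open>lift_bit\<close>), so that a single interpolation lemma serves phases as well as
  Boolean polynomials.\<close>

definition lift :: "(nat \<Rightarrow> bit) \<Rightarrow> nat \<Rightarrow> 'a::zero_neq_one" where
  "lift \<sigma> v = of_bit (\<sigma> v)"

lemma lift_eq: "lift \<sigma> v = (if \<sigma> v = 0 then 0 else 1)"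
  by (cases "\<sigma> v") (auto simp: lift_def)

lemma lift_idem [simp]: "lift \<sigma> v * lift \<sigma> v = (lift \<sigma> v :: 'a::comm_ring_1)"
  by (simp add: lift_eq)

lemma lift_bit [simp]: "lift \<sigma> = (\<sigma> :: nat \<Rightarrow> bit)"
  by (auto simp: lift_eq)

text \<open>On 0/1 values, \<open>a + b - 2ab\<close> is exclusive or, so \<open>hat_add\<close> is
  the arithmetic form of addition in \<open>bit\<close>.\<close>

lemma peval_lift_hat: "peval (lift \<sigma>) (hat Q) = (if peval \<sigma> Q = 0 then 0 else 1)"
proof (induction Q rule: bit_bpoly_induct)
  case (add m Q)
  have 2: "2 * p * q = (p * q) + (p * q)" for p q :: "real bpoly"
    by (simp add: algebra_simps)
  have peval_2: "peval (lift \<sigma>) (2 :: real bpoly) = 2"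
    using peval_add[of "lift \<sigma>" 1 "1 :: real bpoly"] by simp
  have m: "(\<Prod>v\<in>vars_of m. lift \<sigma> v) = (if (\<Prod>v\<in>vars_of m. \<sigma> v) = 0 then 0 else (1::real))"
    by (auto simp: lift_eq prod_zero_iff)
  show ?case
    unfolding hat_add 2 by (simp add: peval_mult add m peval_2)
qed simp

section \<open>Variables occurring in sums, products, substitutions and liftings\<close>

lemma Var_add: "Var (p + q) \<subseteq> Var p \<union> Var q"
  using Poly_Mapping.keys_add[of p q] by (auto simp: Var_def)

lemma Var_zero [simp]: "Var 0 = {}"
  by (simp add: Var_def)

lemma Var_uminus [simp]: "Var (- p :: 'a::ab_group_add bpoly) = Var p"
  by (simp add: Var_def in_keys_iff)

lemma Var_diff: "Var (p - q :: 'a::ab_group_add bpoly) \<subseteq> Var p \<union> Var q"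
  using Var_add[of p "- q"] by simp

lemma Var_Const [simp]: "Var (Const c) = {}"
  by (simp add: Var_def Const_def)

lemma Var_one [simp]: "Var (1 :: 'a::zero_neq_one bpoly) = {}"
  by (simp add: Var_def)

lemma Var_Vr [simp]: "Var (Vr y :: 'a::zero_neq_one bpoly) = {y}"
  by (simp add: Var_def Vr_def)

lemma Var_mult: "Var (p * q) \<subseteq> Var p \<union> Var (q :: 'a::comm_ring_1 bpoly)"
  using keys_mult[of p q] by (fastforce simp: Var_def)

lemma Var_sum: "Var (sum f A) \<subseteq> (\<Union>x\<in>A. Var (f x))"
proof (induction A rule: infinite_finite_induct)
  case (insert x F)
  then show ?case using Var_add[of "f x" "sum f F"] by auto
qed auto

lemma Var_prod: "Var (prod f A) \<subseteq> (\<Union>x\<in>A. Var (f x :: 'a::comm_ring_1 bpoly))"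
proof (induction A rule: infinite_finite_induct)
  case (insert x F)
  then show ?case using Var_mult[of "f x" "prod f F"] by auto
qed auto

lemma Var_psubst: "Var (psubst f p) \<subseteq> (\<Union>v\<in>Var p. Var (f v))"
proof -
  have "Var (psubst f p) \<subseteq> (\<Union>m \<in> Poly_Mapping.keys p. Var (\<Prod>v \<in> vars_of m. f v))"
    unfolding psubst_def by (rule subset_trans[OF Var_sum]) (use Var_mult in \<open>force simp: subset_iff\<close>)
  also have "\<dots> \<subseteq> (\<Union>m \<in> Poly_Mapping.keys p. \<Union>v \<in> vars_of m. Var (f v))"
    using Var_prod by fast
  finally show ?thesis by (auto simp: Var_def)
qed

lemma Var_psubst1: "Var (psubst1 y q p) \<subseteq> (Var p - {y}) \<union> Var q"
  using Var_psubst[of "Vr(y := q)" p] unfolding psubst1_def by (auto split: if_splits)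

lemma Var_hat: "Var (hat Q) \<subseteq> Var Q"
proof -
  have "Var (1 - 2 * Poly_Mapping.single m (1::real)) \<subseteq> vars_of m" for m :: smon
    using Var_diff[of 1 "2 * Poly_Mapping.single m (1::real)"]
      Var_mult[of "2 :: real bpoly" "Poly_Mapping.single m (1::real)"] Var_add[of "1::real bpoly" 1]
    by (auto simp: Var_def)
  then have "(\<Union>m\<in>Poly_Mapping.keys Q. Var (1 - 2 * Poly_Mapping.single m (1::real))) \<subseteq> Var Q"
    unfolding Var_def[of Q] by (intro UN_mono) auto
  then have "Var (\<Prod>m \<in> Poly_Mapping.keys Q. 1 - 2 * Poly_Mapping.single m (1::real)) \<subseteq> Var Q"
    by (rule subset_trans[OF Var_prod])
  then show ?thesis
    unfolding hat_def
    using Var_mult[of "Const (1/2)" "1 - (\<Prod>m \<in> Poly_Mapping.keys Q. 1 - 2 * Poly_Mapping.single m (1::real))"]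
      Var_diff[of 1 "\<Prod>m \<in> Poly_Mapping.keys Q. 1 - 2 * Poly_Mapping.single m (1::real)"] by auto
qed

text \<open>Moebius inversion over the subsets of a monomial.\<close>

lemma lookup_in_subgroup:
  fixes p :: "'a::comm_ring_1 bpoly"
  assumes G0: "0 \<in> G" and Gdiff: "\<And>a b. a \<in> G \<Longrightarrow> b \<in> G \<Longrightarrow> a - b \<in> G"
    and val: "\<And>A. finite A \<Longrightarrow> peval (\<lambda>v. of_bool (v \<in> A)) p \<in> G"
  shows "Poly_Mapping.lookup p m \<in> G"
proof (induction "card (vars_of m)" arbitrary: m rule: less_induct)
  case less
  have Gadd: "a + b \<in> G" if "a \<in> G" "b \<in> G" for a b
    using Gdiff[OF that(1) Gdiff[OF G0 that(2)]] by simp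
  have Gsum: "sum f S \<in> G" if "\<And>x. x \<in> S \<Longrightarrow> f x \<in> G" for f and S :: "smon set"
    using that by (induction S rule: infinite_finite_induct) (auto intro: G0 Gadd)
  let ?S = "insert m (Poly_Mapping.keys p)"
  \<comment> \<open>\<open>f m'\<close> is the contribution of \<open>m'\<close> to the value at the
    indicator of \<open>vars_of m\<close>: only submonomials of \<open>m\<close> survive, and the
    proper ones are covered by the induction.\<close>
  define f where "f m' = Poly_Mapping.lookup p m' * of_bool (vars_of m' \<subseteq> vars_of m)" for m'
  have "(\<Prod>v\<in>vars_of m'. of_bool (v \<in> vars_of m)) = (of_bool (vars_of m' \<subseteq> vars_of m) :: 'a)" for m'
  proof (cases "vars_of m' \<subseteq> vars_of m")
    case True
    then show ?thesis by (simp add: subset_iff)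
  next
    case False
    then have "\<exists>v\<in>vars_of m'. of_bool (v \<in> vars_of m) = (0 :: 'a)" by auto
    then show ?thesis using False by (simp add: prod_zero)
  qed
  then have "peval (\<lambda>v. of_bool (v \<in> vars_of m)) p = sum f ?S"
    by (subst peval_superset[of ?S]) (auto simp: f_def)
  also have "\<dots> = f m + sum f (?S - {m})"
    by (rule sum.remove) auto
  also have "f m = Poly_Mapping.lookup p m" by (simp add: f_def)
  finally have "Poly_Mapping.lookup p m
      = peval (\<lambda>v. of_bool (v \<in> vars_of m)) p - sum f (?S - {m})"
    by simp
  moreover have "f m' \<in> G" if "m' \<in> ?S - {m}" for m'
  proof (cases "vars_of m' \<subseteq> vars_of m")
    case True
    moreover have "vars_of m' \<noteq> vars_of m" using that by (auto simp: vars_of_inject)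
    ultimately have "card (vars_of m') < card (vars_of m)"
      by (intro psubset_card_mono) auto
    then show ?thesis using less True by (simp add: f_def)
  qed (simp add: f_def G0)
  ultimately show ?case by (auto intro!: Gdiff val Gsum)
qed

text \<open>The trivial subgroup in \<open>lookup_in_subgroup\<close>, applied to the difference of
  the two polynomials.\<close>

lemma bit_bpoly_eqI:
  assumes "\<And>\<sigma>. peval \<sigma> p = peval \<sigma> q"
  shows "p = (q :: bit bpoly)"
proof (rule poly_mapping_eqI)
  fix m
  have "Poly_Mapping.lookup (p - q) m \<in> {0}"
    by (rule lookup_in_subgroup) (auto simp: assms)
  then have "Poly_Mapping.lookup p m - Poly_Mapping.lookup q m = 0"
    by (simp only: lookup_minus singleton_iff)
  then show "Poly_Mapping.lookup p m = Poly_Mapping.lookup q m"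
    by (simp only: right_minus_eq)
qed

text \<open>The subgroup of integers in \<open>lookup_in_subgroup\<close>. Congruence of phase
  polynomials modulo integer polynomials thereby becomes a pointwise condition.\<close>

lemma int_coeffsI:
  assumes "\<And>\<sigma> :: nat \<Rightarrow> bit. peval (lift \<sigma>) p \<in> \<int>"
  shows "int_coeffs p"
  unfolding int_coeffs_def
proof
  fix m
  show "Poly_Mapping.lookup p m \<in> \<int>"
  proof (rule lookup_in_subgroup)
    fix A :: "nat set"
    show "peval (\<lambda>v. of_bool (v \<in> A)) p \<in> \<int>"
      using assms[of "\<lambda>v. of_bool (v \<in> A)"] by (simp add: lift_def[abs_def])
  qed auto
qed

lemma int_coeffsD:
  assumes "int_coeffs p"
  shows "peval (lift \<sigma>) p \<in> \<int>"
  unfolding peval_def using assms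
  by (intro Ints_sum Ints_mult Ints_prod) (auto simp: int_coeffs_def lift_eq)

text \<open>Interpolation by expanding in one variable at a time: if \<open>p 0\<close> and
  \<open>p 1\<close> represent the two restrictions to \<open>x = 0\<close> and
  \<open>x = 1\<close>, then \<open>p 0 + x * (p 1 - p 0)\<close> represents the whole
  function.\<close>

lemma bpoly_exists:
  fixes g :: "(nat \<Rightarrow> bit) \<Rightarrow> 'a::comm_ring_1"
  assumes "finite V" and "\<And>\<sigma> \<tau>. (\<And>v. v \<in> V \<Longrightarrow> \<sigma> v = \<tau> v) \<Longrightarrow> g \<sigma> = g \<tau>"
  shows "\<exists>p. Var p \<subseteq> V \<and> (\<forall>\<sigma>. peval (lift \<sigma>) p = g \<sigma>)"
  using assms
proof (induction V arbitrary: g rule: finite_induct)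
  case empty
  then have "g (\<lambda>_. 0) = g \<sigma>" for \<sigma> by blast
  then show ?case by (intro exI[of _ "Const (g (\<lambda>_. 0))"]) (simp only: Var_Const peval_Const, blast)
next
  case (insert x V)
  have "\<exists>p. Var p \<subseteq> V \<and> (\<forall>\<sigma>. peval (lift \<sigma>) p = g (\<sigma>(x := b)))" for b
    by (rule insert.IH, rule insert.prems) auto
  then obtain p where p: "\<And>b. Var (p b) \<subseteq> V"
    "\<And>b \<sigma>. peval (lift \<sigma>) (p b) = g (\<sigma>(x := b))"
    by metis
  let ?q = "p 0 + Vr x * (p 1 - p 0)"
  have "Var ?q \<subseteq> insert x V"
    using Var_add[of "p 0" "Vr x * (p 1 - p 0)"] Var_mult[of "Vr x" "p 1 - p 0"]
      Var_diff[of "p 1" "p 0"] p(1)[of 0] p(1)[of 1] unfolding Var_Vr by blast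
  moreover have "peval (lift \<sigma>) ?q = g \<sigma>" for \<sigma>
  proof -
    have "\<sigma> = \<sigma>(x := \<sigma> x)" by simp
    then show ?thesis
      by (cases "\<sigma> x") (simp_all add: peval_mult p(2) lift_eq)
  qed
  ultimately show ?case by blast
qed

section \<open>Paths of a morphism\<close>

type_synonym path = "complex \<times> bit list \<times> bit list"

text \<open>The phase is recorded as a unit complex number rather than as a real exponent, which
  makes changes by integer polynomials invisible.\<close>

definition path_at :: "sop \<Rightarrow> (nat \<Rightarrow> bit) \<Rightarrow> path" where
  "path_at t \<sigma> = (exp (2 * \<i> * complex_of_real pi * complex_of_real (peval (lift \<sigma>) (phase t))),
     map (peval \<sigma>) (outs t), map (peval \<sigma>) (ins t))"

abbreviation assignments :: "nat set \<Rightarrow> (nat \<Rightarrow> bit) set" where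
  "assignments V \<equiv> V \<rightarrow>\<^sub>E UNIV"

definition paths :: "sop \<Rightarrow> path multiset" where
  "paths t = image_mset (path_at t) (mset_set (assignments (svars t)))"

text \<open>These conditions characterise the triples that can occur as paths of a morphism:
  \<open>wf_path_at\<close> shows that they hold, and \<open>sop_exists\<close> that they
  suffice.\<close>

definition wf_path :: "nat \<Rightarrow> nat \<Rightarrow> path \<Rightarrow> bool" where
  "wf_path n m e \<longleftrightarrow> norm (fst e) = 1 \<and> length (fst (snd e)) = m \<and> length (snd (snd e)) = n"

definition neg :: "path \<Rightarrow> path" where
  "neg e = (- fst e, snd e)"

abbreviation twist :: "bool \<Rightarrow> path \<Rightarrow> path" where
  "twist b e \<equiv> (if b then neg e else e)"

lemma wf_path_neg [simp]: "wf_path n m (neg e) \<longleftrightarrow> wf_path n m e"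
  by (simp add: wf_path_def neg_def)

lemma UNIV_bit: "(UNIV :: bit set) = {0, 1}"
  using bit_not_zero_iff by blast

lemma finite_assignments [simp]: "finite V \<Longrightarrow> finite (assignments V)"
  by (simp add: finite_PiE UNIV_bit)

lemma finite_svars: "t \<in> SOP n m \<Longrightarrow> finite (svars t)"
  by (simp add: SOP_def)

lemma exp_2pi_eq_iff:
  "exp (2 * \<i> * complex_of_real pi * complex_of_real x) = exp (2 * \<i> * complex_of_real pi * complex_of_real y)
    \<longleftrightarrow> x - y \<in> \<int>"
proof -
  have "2 * \<i> * complex_of_real pi * complex_of_real x =
      2 * \<i> * complex_of_real pi * complex_of_real y + of_int (2 * n) * complex_of_real pi * \<i>
      \<longleftrightarrow> x - y = of_int n" for n
  proof -
    have "2 * \<i> * complex_of_real pi * complex_of_real y + of_int (2 * n) * complex_of_real pi * \<i>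
        = 2 * \<i> * complex_of_real pi * complex_of_real (y + of_int n)"
      by (simp add: algebra_simps)
    then have "2 * \<i> * complex_of_real pi * complex_of_real x =
      2 * \<i> * complex_of_real pi * complex_of_real y + of_int (2 * n) * complex_of_real pi * \<i>
      \<longleftrightarrow> x = y + of_int n"
      by (simp only: mult_cancel_left of_real_eq_iff) simp
    then show ?thesis by auto
  qed
  then show ?thesis unfolding exp_eq by (simp add: Ints_def image_iff)
qed

text \<open>A phase in half integers contributes only a sign, determined by parity; this is how the
  patterns in \<open>HHgen\<close> and \<open>Z\<close> act on paths.\<close>

lemma exp_half_shift:
  "exp (2 * \<i> * complex_of_real pi * complex_of_real (of_nat k / 2 + r))
    = (if even k then 1 else -1) * exp (2 * \<i> * complex_of_real pi * complex_of_real r)"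
proof -
  have "exp (2 * \<i> * complex_of_real pi * complex_of_real (of_nat k / 2 + r))
      = exp (of_nat k * (\<i> * complex_of_real pi)) * exp (2 * \<i> * complex_of_real pi * complex_of_real r)"
    unfolding exp_add[symmetric] by (simp add: algebra_simps)
  also have "exp (of_nat k * (\<i> * complex_of_real pi)) = (- 1) ^ k"
    by (simp add: exp_of_nat_mult mult.commute)
  finally show ?thesis by simp
qed

lemma path_at_cong:
  assumes "t \<in> SOP n m" "\<And>v. v \<in> svars t \<Longrightarrow> \<sigma> v = \<tau> v"
  shows "path_at t \<sigma> = path_at t \<tau>"
  using assms unfolding path_at_def SOP_def
  by (auto intro!: peval_cong arg_cong[where f = exp] simp: lift_def subset_iff)

lemma path_at_restrict:
  assumes "t \<in> SOP n m"
  shows "path_at t (restrict \<sigma> (svars t)) = path_at t \<sigma>"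
  using assms by (rule path_at_cong) simp

lemma wf_path_at:
  assumes "t \<in> SOP n m"
  shows "wf_path n m (path_at t \<sigma>)"
proof -
  have "norm (exp (2 * \<i> * complex_of_real pi * complex_of_real r)) = 1" for r
    by (simp add: norm_exp_eq_Re)
  then show ?thesis
    using assms by (simp add: wf_path_def path_at_def SOP_def)
qed

lemma interp_paths:
  "interp t x x' = complex_of_real (scal t) * (\<Sum>e\<in>#paths t. fst e * of_bool (snd e = (x, x')))"
proof -
  have "interp t x x' = complex_of_real (scal t) *
      (\<Sum>\<sigma>\<in>assignments (svars t). fst (path_at t \<sigma>) * of_bool (snd (path_at t \<sigma>) = (x, x')))"
    unfolding interp_def path_at_def ket_bra_def lift_def[abs_def]
    by (intro arg_cong2[where f = "(*)"] refl sum.cong) auto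
  then show ?thesis
    by (simp only: sum_unfold_sum_mset paths_def image_mset.compositionality comp_def)
qed

lemma assignments_reindex:
  assumes "bij_betw f V V'"
  shows "bij_betw (\<lambda>\<sigma>. restrict (\<sigma> \<circ> f) V) (assignments V') (assignments V)"
proof (rule bij_betw_byWitness[where f' = "\<lambda>\<sigma>. restrict (\<sigma> \<circ> inv_into V f) V'"])
  have f: "\<And>v. v \<in> V \<Longrightarrow> f v \<in> V'" "\<And>v. v \<in> V' \<Longrightarrow> inv_into V f v \<in> V"
    "\<And>v. v \<in> V \<Longrightarrow> inv_into V f (f v) = v" "\<And>v. v \<in> V' \<Longrightarrow> f (inv_into V f v) = v"
    using assms by (auto simp: bij_betw_def inv_into_into f_inv_into_f)
  show "\<forall>\<sigma>\<in>assignments V'. restrict (restrict (\<sigma> \<circ> f) V \<circ> inv_into V f) V' = \<sigma>"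
    using f by (auto simp: fun_eq_iff restrict_def PiE_def extensional_def)
  show "\<forall>\<sigma>\<in>assignments V. restrict (restrict (\<sigma> \<circ> inv_into V f) V' \<circ> f) V = \<sigma>"
    using f by (auto simp: fun_eq_iff restrict_def PiE_def extensional_def)
qed auto

lemma sop_identE:
  assumes "sop_ident t t'"
  obtains f where "bij_betw f (svars t) (svars t')" "scal t' = scal t"
    "\<And>\<sigma>. path_at t' \<sigma> = path_at t (\<sigma> \<circ> f)"
proof -
  obtain f where f: "bij_betw f (svars t) (svars t')" "scal t' = scal t"
      "int_coeffs (phase t' - rename f (phase t))"
      "outs t' = map (rename f) (outs t)" "ins t' = map (rename f) (ins t)"
    using assms by (auto simp: sop_ident_def)
  have "path_at t' \<sigma> = path_at t (\<sigma> \<circ> f)" for \<sigma>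
  proof -
    have "peval (lift \<sigma>) (phase t' - rename f (phase t)) \<in> \<int>"
      by (rule int_coeffsD) (rule f(3))
    moreover have "(\<lambda>v. lift \<sigma> (f v)) = (lift (\<sigma> \<circ> f) :: nat \<Rightarrow> real)"
      by (simp add: lift_def fun_eq_iff)
    ultimately show ?thesis
      unfolding path_at_def f(4,5)
      by (simp add: exp_2pi_eq_iff peval_rename bit_idem comp_def)
  qed
  with f that show thesis by blast
qed

text \<open>Boolean polynomials are determined by their values, and phases modulo integer
  polynomials by their values modulo 1. Hence comparing path functions is enough to identify
  records.\<close>

lemma sop_identI:
  assumes "bij_betw f (svars t) (svars t')" "scal t' = scal t"
    and path: "\<And>\<sigma>. path_at t' \<sigma> = path_at t (\<sigma> \<circ> f)"
  shows "sop_ident t t'"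
  unfolding sop_ident_def
proof (intro exI conjI)
  have lift: "(\<lambda>v. lift \<sigma> (f v)) = (lift (\<sigma> \<circ> f) :: nat \<Rightarrow> real)" for \<sigma>
    by (simp add: lift_def fun_eq_iff)
  show "int_coeffs (phase t' - rename f (phase t))"
    using path by (intro int_coeffsI) (simp add: path_at_def exp_2pi_eq_iff peval_rename lift)
  have bits: "qs' = map (rename f) qs"
    if "\<And>\<sigma>. map (peval \<sigma>) qs' = map (peval (\<sigma> \<circ> f)) qs" for qs qs' :: "bit bpoly list"
  proof (rule nth_equalityI)
    show len: "length qs' = length (map (rename f) qs)"
      using that[of undefined] by (metis length_map)
    fix i assume i: "i < length qs'"
    have "peval \<sigma> (qs' ! i) = peval \<sigma> (rename f (qs ! i))" for \<sigma>
      using arg_cong[OF that[of \<sigma>], of "\<lambda>xs. xs ! i"] i len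
      by (simp add: peval_rename bit_idem comp_def)
    then show "qs' ! i = map (rename f) qs ! i"
      using i len by (simp add: bit_bpoly_eqI)
  qed
  show "outs t' = map (rename f) (outs t)" "ins t' = map (rename f) (ins t)"
    using path by (auto intro!: bits simp: path_at_def)
qed fact+

lemma paths_sop_ident:
  assumes "t \<in> SOP n m" "sop_ident t t'"
  shows "paths t' = paths t"
proof -
  obtain f where f: "bij_betw f (svars t) (svars t')"
    "\<And>\<sigma>. path_at t' \<sigma> = path_at t (\<sigma> \<circ> f)"
    using sop_identE[OF assms(2)] by metis
  have "paths t = image_mset (path_at t) (image_mset (\<lambda>\<sigma>. restrict (\<sigma> \<circ> f) (svars t)) (mset_set (assignments (svars t'))))"
    using assignments_reindex[OF f(1)] by (simp add: paths_def bij_betw_def image_mset_mset_set)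
  then show ?thesis
    by (simp add: paths_def image_mset.compositionality comp_def f(2)[abs_def] path_at_restrict[OF assms(1), unfolded comp_def])
qed

section \<open>The generated equivalence, and morphisms with prescribed path functions\<close>

lemma TH_equiv_refl [simp]: "TH_equiv n m t t"
  by (simp add: TH_equiv_def)

lemma TH_equiv_sym: "TH_equiv n m t t' \<Longrightarrow> TH_equiv n m t' t"
  unfolding TH_equiv_def by (rule equivclp_sym)

lemma TH_equiv_trans: "TH_equiv n m t t' \<Longrightarrow> TH_equiv n m t' t'' \<Longrightarrow> TH_equiv n m t t''"
  unfolding TH_equiv_def by (rule equivclp_trans)

lemma TH_equiv_step:
  "t \<in> SOP n m \<Longrightarrow> t' \<in> SOP n m \<Longrightarrow> sop_ident t t' \<or> TH_step t t' \<Longrightarrow> TH_equiv n m t t'"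
  unfolding TH_equiv_def by (rule r_into_equivclp) simp

text \<open>The identity renaming in \<open>sop_identI\<close>. It allows later arguments to specify
  a morphism by its path function, whatever polynomials represent it.\<close>

lemma TH_equiv_path_at:
  assumes "t \<in> SOP n m" "t' \<in> SOP n m" "svars t' = svars t" "scal t' = scal t"
    and "\<And>\<sigma>. path_at t' \<sigma> = path_at t \<sigma>"
  shows "TH_equiv n m t t'"
  using assms by (intro TH_equiv_step disjI1 sop_identI[where f = id]) auto

lemma bit_polys_exist:
  fixes F :: "(nat \<Rightarrow> bit) \<Rightarrow> bit list"
  assumes "finite V" and "\<And>\<sigma>. length (F \<sigma>) = l"
    and "\<And>\<sigma> \<tau>. (\<And>v. v \<in> V \<Longrightarrow> \<sigma> v = \<tau> v) \<Longrightarrow> F \<sigma> = F \<tau>"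
  shows "\<exists>qs. length qs = l \<and> (\<forall>q \<in> set qs. Var q \<subseteq> V) \<and> (\<forall>\<sigma>. map (peval \<sigma>) qs = F \<sigma>)"
proof -
  have "\<exists>p. Var p \<subseteq> V \<and> (\<forall>\<sigma>. peval \<sigma> p = F \<sigma> ! i)" for i
    using bpoly_exists[OF assms(1), of "\<lambda>\<sigma>. F \<sigma> ! i"] assms(3) by (metis lift_bit)
  then obtain p where p: "\<And>i. Var (p i) \<subseteq> V" "\<And>i \<sigma>. peval \<sigma> (p i) = F \<sigma> ! i"
    by metis
  have "map (peval \<sigma>) (map p [0..<l]) = F \<sigma>" for \<sigma>
    by (rule nth_equalityI) (simp_all add: p assms(2))
  then show ?thesis using p(1) by (intro exI[of _ "map p [0..<l]"]) auto
qed

text \<open>Interpolate each output and input bit, and for the phase the argument of the unit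
  complex number divided by \<open>2 * pi\<close>.\<close>

lemma sop_exists:
  assumes V: "finite V" and wf: "\<And>\<sigma>. wf_path n m (F \<sigma>)"
    and dep: "\<And>\<sigma> \<tau>. (\<And>v. v \<in> V \<Longrightarrow> \<sigma> v = \<tau> v) \<Longrightarrow> F \<sigma> = F \<tau>"
  shows "\<exists>t. t \<in> SOP n m \<and> scal t = s \<and> svars t = V \<and> (\<forall>\<sigma>. path_at t \<sigma> = F \<sigma>)"
proof -
  have "\<exists>r. fst (F \<sigma>) = exp (2 * \<i> * complex_of_real pi * complex_of_real r)" for \<sigma>
  proof -
    have "norm (fst (F \<sigma>)) = 1" using wf by (simp add: wf_path_def)
    then have "fst (F \<sigma>) = cis (Arg (fst (F \<sigma>)))"
      by (subst cis_Arg) (auto simp: sgn_eq)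
    then have "fst (F \<sigma>) = exp (2 * \<i> * complex_of_real pi * complex_of_real (Arg (fst (F \<sigma>)) / (2 * pi)))"
      by (simp add: cis_conv_exp)
    then show ?thesis by blast
  qed
  then obtain r where r: "\<And>\<sigma>. fst (F \<sigma>) = exp (2 * \<i> * complex_of_real pi * complex_of_real (r \<sigma>))"
    by metis
  \<comment> \<open>The chosen exponent \<open>r \<sigma>\<close> may depend on coordinates outside
    \<open>V\<close>, although the complex number does not. Restricting first removes this
    dependence, so that interpolation applies.\<close>
  define r' where "r' \<sigma> = r (restrict \<sigma> V)" for \<sigma>
  have F: "F (restrict \<sigma> V) = F \<sigma>" for \<sigma> by (rule dep) simp
  have "\<exists>P. Var P \<subseteq> V \<and> (\<forall>\<sigma>. peval (lift \<sigma>) P = r' \<sigma>)"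
    by (rule bpoly_exists[OF V]) (auto simp: r'_def restrict_def intro!: arg_cong[where f = r])
  then obtain P where P: "Var P \<subseteq> V" "\<And>\<sigma>. peval (lift \<sigma>) P = r' \<sigma>" by blast
  obtain os where os: "length os = m" "\<forall>q\<in>set os. Var q \<subseteq> V" "\<And>\<sigma>. map (peval \<sigma>) os = fst (snd (F \<sigma>))"
    using bit_polys_exist[OF V, of "\<lambda>\<sigma>. fst (snd (F \<sigma>))" m] wf dep unfolding wf_path_def by metis
  obtain iv where iv: "length iv = n" "\<forall>q\<in>set iv. Var q \<subseteq> V" "\<And>\<sigma>. map (peval \<sigma>) iv = snd (snd (F \<sigma>))"
    using bit_polys_exist[OF V, of "\<lambda>\<sigma>. snd (snd (F \<sigma>))" n] wf dep unfolding wf_path_def by metis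
  let ?t = "\<lparr>scal = s, svars = V, phase = P, outs = os, ins = iv\<rparr>"
  have "?t \<in> SOP n m" using V P(1) os iv by (simp add: SOP_def)
  moreover have "path_at ?t \<sigma> = F \<sigma>" for \<sigma>
    by (simp add: path_at_def P os iv r'_def r[symmetric] F)
  ultimately show ?thesis by (intro exI[of _ ?t]) simp
qed

lemma sop_exists_on:
  assumes V: "finite V" and wf: "\<And>\<sigma>. \<sigma> \<in> assignments V \<Longrightarrow> wf_path n m (F \<sigma>)"
  shows "\<exists>t. t \<in> SOP n m \<and> scal t = s \<and> svars t = V \<and> (\<forall>\<sigma>\<in>assignments V. path_at t \<sigma> = F \<sigma>)"
proof -
  have "\<exists>t. t \<in> SOP n m \<and> scal t = s \<and> svars t = V \<and> (\<forall>\<sigma>. path_at t \<sigma> = F (restrict \<sigma> V))"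
  proof (rule sop_exists[OF V])
    show "wf_path n m (F (restrict \<sigma> V))" for \<sigma> by (rule wf) simp
    show "F (restrict \<sigma> V) = F (restrict \<tau> V)" if "\<And>v. v \<in> V \<Longrightarrow> \<sigma> v = \<tau> v" for \<sigma> \<tau>
      using that by (auto intro!: arg_cong[where f = F])
  qed
  then show ?thesis by (metis PiE_restrict)
qed

section \<open>Soundness and the rules in terms of paths\<close>

lemma lift_upd: "lift (\<sigma>(y := b)) = (lift \<sigma>)(y := if b = 0 then 0 else 1)"
  by (auto simp: lift_eq fun_eq_iff)

lemma path_at_simps [simp]:
  "path_at (t\<lparr>scal := s\<rparr>) \<sigma> = path_at t \<sigma>"
  "path_at (t\<lparr>svars := V\<rparr>) \<sigma> = path_at t \<sigma>"
  by (simp_all add: path_at_def)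

text \<open>Since \<open>hat Q\<close> and \<open>Q\<close> have the same 0/1 values, substituting
  them in the phase and in the bits amounts to one change of the assignment.\<close>

lemma path_at_sop_subst:
  "path_at (sop_subst y Q t) \<sigma> = path_at t (\<sigma>(y := peval \<sigma> Q))"
  by (simp add: path_at_def sop_subst_def peval_psubst1 bit_idem lift_upd peval_lift_hat comp_def)

lemma sop_subst_simps [simp]: "scal (sop_subst y Q t) = scal t" "svars (sop_subst y Q t) = svars t"
  by (simp_all add: sop_subst_def)

lemma path_at_upd:
  assumes "y \<notin> Var (phase t) \<union> Vars (outs t) \<union> Vars (ins t)"
  shows "path_at t (\<sigma>(y := b)) = path_at t \<sigma>"
  using assms unfolding path_at_def
  by (auto intro!: peval_cong arg_cong[where f = exp] simp: lift_def)

lemma path_at_half: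
  assumes "\<And>\<sigma>. peval (lift \<sigma>) P = real (k \<sigma>) / 2"
    and "phase t = P + R"
  shows "path_at t \<sigma> = twist (odd (k \<sigma>)) (path_at (t\<lparr>phase := R\<rparr>) \<sigma>)"
  by (simp add: path_at_def assms exp_half_shift neg_def del: of_real_add)

lemma path_at_HH:
  assumes "phase t = Const (1/2) * Vr y0 * (Vr yi * hat Q + hat Q' + 1) + R"
  shows "path_at t \<sigma> = twist (\<sigma> y0 = 1 \<and> \<sigma> yi * peval \<sigma> Q + peval \<sigma> Q' = 0) (path_at (t\<lparr>phase := R\<rparr>) \<sigma>)"
proof -
  \<comment> \<open>The integer whose half is the value of the pattern. Only its parity matters,
    which is read off from the four bits involved.\<close>
  define k :: "(nat \<Rightarrow> bit) \<Rightarrow> nat" where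
    "k \<sigma> = (if \<sigma> y0 = 0 then 0 else 1) * ((if \<sigma> yi = 0 then 0 else 1) * (if peval \<sigma> Q = 0 then 0 else 1)
       + (if peval \<sigma> Q' = 0 then 0 else 1) + 1)" for \<sigma>
  have "path_at t \<sigma> = twist (odd (k \<sigma>)) (path_at (t\<lparr>phase := R\<rparr>) \<sigma>)"
    by (rule path_at_half[OF _ assms]) (auto simp: peval_mult peval_lift_hat k_def lift_eq)
  moreover have "odd (k \<sigma>) \<longleftrightarrow> \<sigma> y0 = 1 \<and> \<sigma> yi * peval \<sigma> Q + peval \<sigma> Q' = 0"
    unfolding k_def by (cases "\<sigma> y0"; cases "\<sigma> yi"; cases "peval \<sigma> Q"; cases "peval \<sigma> Q'") auto
  ultimately show ?thesis by simp
qed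

lemma mset_assignments_insert:
  assumes "finite V" "y \<notin> V"
  shows "mset_set (assignments (insert y V)) =
    image_mset (\<lambda>\<sigma>. \<sigma>(y := 0)) (mset_set (assignments V)) + image_mset (\<lambda>\<sigma>. \<sigma>(y := 1)) (mset_set (assignments V))"
proof -
  let ?A = "\<lambda>b :: bit. (\<lambda>\<sigma>. \<sigma>(y := b)) ` assignments V"
  have inj: "inj_on (\<lambda>\<sigma>. \<sigma>(y := b)) (assignments V)" for b
  proof (rule inj_onI, rule ext)
    fix \<sigma> \<tau> v assume "\<sigma> \<in> assignments V" "\<tau> \<in> assignments V" "\<sigma>(y := b) = \<tau>(y := b)"
    then show "\<sigma> v = \<tau> v"
      using assms(2) by (cases "v = y") (auto simp: PiE_def extensional_def dest: fun_cong[where x = v])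
  qed
  have "assignments (insert y V) = ?A 0 \<union> ?A 1"
    unfolding PiE_insert_eq UNIV_bit by auto
  moreover have "?A 0 \<inter> ?A 1 = {}"
    by (auto dest: fun_cong[where x = y])
  ultimately show ?thesis
    using assms by (simp add: mset_set_Union image_mset_mset_set inj)
qed

lemma sum_assignments_insert:
  assumes "finite V" "y \<notin> V"
  shows "(\<Sum>\<sigma>\<in>assignments (insert y V). f \<sigma>)
    = (\<Sum>\<sigma>\<in>assignments V. f (\<sigma>(y := 0)) + f (\<sigma>(y := 1)) :: 'a::comm_monoid_add)"
  unfolding sum.distrib sum_unfold_sum_mset mset_assignments_insert[OF assms]
  by (simp add: image_mset.compositionality comp_def)

text \<open>The unscaled contribution of a path to one matrix entry.\<close>

definition weight :: "bit list \<Rightarrow> bit list \<Rightarrow> path \<Rightarrow> complex" where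
  "weight x x' e = fst e * of_bool (snd e = (x, x'))"

lemma weight_neg [simp]: "weight x x' (neg e) = - weight x x' e"
  by (simp add: weight_def neg_def)

lemma interp_weight:
  "interp t x x' = complex_of_real (scal t) * (\<Sum>\<sigma>\<in>assignments (svars t). weight x x' (path_at t \<sigma>))"
  by (simp add: interp_paths sum_unfold_sum_mset paths_def weight_def image_mset.compositionality comp_def)

lemma interp_sop_ident:
  assumes "t \<in> SOP n m" "sop_ident t t'"
  shows "interp t' = interp t"
  using paths_sop_ident[OF assms] assms(2) by (auto simp: fun_eq_iff interp_paths sop_ident_def)

text \<open>With the other variables fixed, adding the value of \<open>g\<close> to \<open>y\<close>
  either keeps or swaps the two summands. The rules \<open>ket\<close> and \<open>bra\<close> are
  both of this form.\<close>

lemma interp_shear: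
  assumes "finite (svars t)" "y \<in> svars t" "y \<notin> Var g"
  shows "interp (sop_subst y (Vr y + g) t) = interp t"
proof (intro ext)
  fix x x'
  define V where "V = svars t - {y}"
  have V: "finite V" "y \<notin> V" "svars t = insert y V"
    using assms by (auto simp: V_def)
  have "peval (\<sigma>(y := b)) g = peval \<sigma> g" for \<sigma> b
    using assms(3) by (intro peval_cong) auto
  then have path: "path_at (sop_subst y (Vr y + g) t) (\<sigma>(y := b)) = path_at t (\<sigma>(y := b + peval \<sigma> g))" for \<sigma> b
    by (simp add: path_at_sop_subst)
  let ?w = "\<lambda>\<sigma>. weight x x' (path_at t \<sigma>)"
  have "?w (\<sigma>(y := 0 + c)) + ?w (\<sigma>(y := 1 + c)) = ?w (\<sigma>(y := 0)) + ?w (\<sigma>(y := 1))" for \<sigma> c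
    by (cases c) (auto simp: add.commute)
  then have "(\<Sum>\<sigma>\<in>assignments (svars t). weight x x' (path_at (sop_subst y (Vr y + g) t) \<sigma>))
      = (\<Sum>\<sigma>\<in>assignments (svars t). ?w \<sigma>)"
    unfolding V(3) sum_assignments_insert[OF V(1,2)] path by (intro sum.cong refl)
  then show "interp (sop_subst y (Vr y + g) t) x x' = interp t x x'"
    unfolding interp_weight by (simp add: sop_subst_def)
qed

text \<open>The two values of \<open>y0\<close> give opposite paths, which cancel in every matrix
  entry.\<close>

lemma interp_Z:
  assumes "finite (svars t)" "y0 \<in> svars t" "phase t = Const (1/2) * Vr y0 + R"
    "y0 \<notin> Var R \<union> Vars (outs t) \<union> Vars (ins t)"
  shows "interp t x x' = 0"
proof -
  define V where "V = svars t - {y0}"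
  have V: "finite V" "y0 \<notin> V" "svars t = insert y0 V"
    using assms by (auto simp: V_def)
  define k :: "(nat \<Rightarrow> bit) \<Rightarrow> nat" where "k \<sigma> = (if \<sigma> y0 = 0 then 0 else 1)" for \<sigma>
  have path: "path_at t \<sigma> = twist (odd (k \<sigma>)) (path_at (t\<lparr>phase := R\<rparr>) \<sigma>)" for \<sigma>
    by (rule path_at_half[OF _ assms(3)]) (auto simp: peval_mult k_def lift_eq)
  have "path_at (t\<lparr>phase := R\<rparr>) (\<sigma>(y0 := b)) = path_at (t\<lparr>phase := R\<rparr>) \<sigma>" for \<sigma> b
    using assms(4) by (intro path_at_upd) auto
  then show ?thesis
    unfolding interp_weight by (simp add: V sum_assignments_insert path k_def)
qed

lemma interp_TH_step:
  assumes "TH_step t t'" "t \<in> SOP n m"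
  shows "interp t' = interp t"
  using assms
proof (induction rule: TH_step.induct)
  case (Elim y0 t)
  define V where "V = svars t - {y0}"
  have V: "finite V" "y0 \<notin> V" "svars t = insert y0 V"
    using Elim finite_svars[of t n m] by (auto simp: V_def)
  have "path_at t (\<sigma>(y0 := b)) = path_at t \<sigma>" for \<sigma> b
    using Elim by (intro path_at_upd) auto
  then show ?case
    by (intro ext) (simp add: interp_weight V sum_assignments_insert sum_distrib_left mult_ac)
next
  case (HHgen y0 t yi Q Q' R)
  define V where "V = svars t - {y0, yi}"
  have V: "finite V" "y0 \<notin> insert yi V" "yi \<notin> insert y0 V" "svars t = insert y0 (insert yi V)"
    using HHgen finite_svars[of t n m] by (auto simp: V_def)
  have V': "svars t - {yi} = insert y0 V" using V by auto
  let ?G = "t\<lparr>phase := R\<rparr>"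
  have indep: "path_at ?G (\<sigma>(y0 := b)) = path_at ?G \<sigma>" for \<sigma> b
    using HHgen by (intro path_at_upd) auto
  have indep2: "path_at ?G (\<sigma>(y0 := b, yi := c)) = path_at ?G (\<sigma>(yi := c))" for \<sigma> b c
    using indep[of "\<sigma>(yi := c)" b] HHgen by (simp add: fun_upd_twist)
  have Q: "peval (\<sigma>(yi := b)) Q = peval \<sigma> Q" "peval (\<sigma>(yi := b)) Q' = peval \<sigma> Q'"
    "peval (\<sigma>(y0 := b)) Q = peval \<sigma> Q" "peval (\<sigma>(y0 := b)) Q' = peval \<sigma> Q'" for \<sigma> b
    using HHgen by (auto intro!: peval_cong)
  have QQ: "peval \<sigma> Q * peval \<sigma> Q' = peval \<sigma> Q'" for \<sigma>
    using arg_cong[OF HHgen(5), of "peval \<sigma>"] by (simp add: peval_mult bit_idem)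
  note path = path_at_HH[OF HHgen(4)]
  show ?case
  proof (intro ext)
    fix x x'
    let ?w = "\<lambda>\<sigma>. weight x x' (path_at t \<sigma>)"
    \<comment> \<open>The two values of \<open>y0\<close> cancel unless
      \<open>yi * Q + Q' = 1\<close>. If \<open>Q = 1\<close>, this forces
      \<open>yi = 1 + Q'\<close>. If \<open>Q = 0\<close>, then \<open>Q' = 0\<close> because
      \<open>Q * Q' = Q'\<close>, and both sides vanish.\<close>
    have "?w (\<sigma>(yi := 0, y0 := 0)) + ?w (\<sigma>(yi := 0, y0 := 1)) + (?w (\<sigma>(yi := 1, y0 := 0)) + ?w (\<sigma>(yi := 1, y0 := 1)))
        = ?w (\<sigma>(y0 := 0, yi := 1 + peval \<sigma> Q')) + ?w (\<sigma>(y0 := 1, yi := 1 + peval \<sigma> Q'))" for \<sigma>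
      using QQ[of \<sigma>] HHgen(3)
      by (cases "peval \<sigma> Q"; cases "peval \<sigma> Q'") (simp_all add: path Q indep indep2)
    then show "interp ((sop_subst yi (1 + Q') t)\<lparr>svars := svars t - {yi}\<rparr>) x x' = interp t x x'"
      unfolding interp_weight V' using V
      by (simp add: V' sum_assignments_insert path_at_sop_subst Q del: add_bit_eq_xor)
  qed
next
  case (ket y0 t i O')
  then show ?case using interp_shear[of t y0 O'] finite_svars[of t n m] by simp
next
  case (bra y0 t i I')
  then show ?case using interp_shear[of t y0 I'] finite_svars[of t n m] by simp
next
  case (Z y0 t R)
  have "interp t x x' = 0" for x x'
    using Z finite_svars[of t n m] by (intro interp_Z) auto
  moreover have "interp \<lparr>scal = 1, svars = {y0}, phase = Const (1/2) * Vr y0,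
      outs = replicate (length (outs t)) 0, ins = replicate (length (ins t)) 0\<rparr> x x' = 0" for x x'
    by (rule interp_Z[of _ y0 0]) auto
  ultimately show ?case by (intro ext) simp
qed

lemma TH_equiv_sound:
  assumes "TH_equiv n m t t'"
  shows "interp t = interp t'"
  using assms unfolding TH_equiv_def
  by (induction rule: equivclp_induct) (auto dest: interp_TH_step interp_sop_ident)

lemma sop_subst_SOP:
  assumes "t \<in> SOP n m" "finite W" "Var Q \<subseteq> W" "svars t - {y} \<subseteq> W"
  shows "(sop_subst y Q t)\<lparr>svars := W\<rparr> \<in> SOP n m"
proof -
  have "Var (psubst1 y (hat Q) (phase t)) \<subseteq> W"
    using Var_psubst1[of y "hat Q" "phase t"] Var_hat[of Q] assms by (simp add: SOP_def) blast
  moreover have "Var (psubst1 y Q q) \<subseteq> W" if "Var q \<subseteq> svars t" for q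
    using Var_psubst1[of y Q q] that assms by auto
  ultimately show ?thesis
    using assms by (auto simp: SOP_def sop_subst_def)
qed

text \<open>The rule in terms of path functions. The polynomial pattern demanded by the rule is
  assembled in \<open>u\<close>, with the phase of \<open>G\<close> in the place of
  \<open>R\<close>; \<open>t\<close> and \<open>t'\<close> are then identified with \<open>u\<close>
  and its reduct.\<close>

lemma TH_equiv_HHgen:
  assumes G: "G \<in> SOP n m" "svars G = insert yi V" "yi \<notin> V" "y0 \<notin> insert yi V"
    and Q: "Var Q \<subseteq> V" "Var Q' \<subseteq> V" "Q * Q' = Q'"
    and t: "t \<in> SOP n m" "scal t = s" "svars t = insert y0 (insert yi V)"
      "\<And>\<sigma>. path_at t \<sigma> = twist (\<sigma> y0 = 1 \<and> \<sigma> yi * peval \<sigma> Q + peval \<sigma> Q' = 0) (path_at G \<sigma>)"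
    and t': "t' \<in> SOP n m" "scal t' = s" "svars t' = insert y0 V"
      "\<And>\<sigma>. path_at t' \<sigma> = twist (\<sigma> y0 = 1 \<and> peval \<sigma> Q = 0) (path_at G (\<sigma>(yi := 1 + peval \<sigma> Q')))"
  shows "TH_equiv n m t t'"
proof -
  define P where "P = Const (1/2) * Vr y0 * (Vr yi * hat Q + hat Q' + 1)"
  define u where "u = G\<lparr>scal := s, svars := insert y0 (insert yi V), phase := P + phase G\<rparr>"
  define u' where "u' = (sop_subst yi (1 + Q') u)\<lparr>svars := svars u - {yi}\<rparr>"
  have fin: "finite V" using finite_svars[OF G(1)] G(2) by simp
  have VarG: "Var (phase G) \<subseteq> insert yi V" "Vars (outs G) \<subseteq> insert yi V" "Vars (ins G) \<subseteq> insert yi V"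
    using G(1,2) by (auto simp: SOP_def)
  have "Var P \<subseteq> insert y0 (insert yi V)"
  proof -
    have "Var P \<subseteq> {y0} \<union> Var (Vr yi * hat Q + hat Q' + 1)"
      unfolding P_def using Var_mult[of "Const (1/2) * Vr y0" "Vr yi * hat Q + hat Q' + 1"]
        Var_mult[of "Const (1/2)" "Vr y0"] by auto
    also have "\<dots> \<subseteq> {y0} \<union> (Var (Vr yi * hat Q) \<union> Var (hat Q'))"
      using Var_add[of "Vr yi * hat Q + hat Q'" 1] Var_add[of "Vr yi * hat Q" "hat Q'"] by auto
    also have "\<dots> \<subseteq> insert y0 (insert yi V)"
      using Var_mult[of "Vr yi" "hat Q"] Var_hat[of Q] Var_hat[of Q'] Q by auto
    finally show ?thesis .
  qed
  then have "Var (P + phase G) \<subseteq> insert y0 (insert yi V)"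
    using Var_add[of P "phase G"] VarG by blast
  then have u: "u \<in> SOP n m"
    using G(1,2) fin by (auto simp: u_def SOP_def)
  have "Var (1 + Q') \<subseteq> V" using Var_add[of 1 Q'] Q by auto
  then have u': "u' \<in> SOP n m"
    unfolding u'_def using G fin by (intro sop_subst_SOP[OF u]) (auto simp: u_def)
  have path: "path_at u \<sigma> = twist (\<sigma> y0 = 1 \<and> \<sigma> yi * peval \<sigma> Q + peval \<sigma> Q' = 0) (path_at G \<sigma>)" for \<sigma>
  proof -
    have "path_at (u\<lparr>phase := phase G\<rparr>) \<sigma> = path_at G \<sigma>"
      by (simp add: u_def path_at_def)
    then show ?thesis
      by (subst path_at_HH[of u y0 yi Q Q' "phase G"]) (auto simp: u_def P_def)
  qed
  \<comment> \<open>At \<open>yi = 1 + Q'\<close> the expression \<open>yi * Q + Q'\<close> equals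
    \<open>Q\<close>, since \<open>Q * Q' = Q'\<close>; the sign therefore appears exactly where
    \<open>y0 = 1\<close> and \<open>Q = 0\<close>.\<close>
  have path': "path_at u' \<sigma> = path_at t' \<sigma>" for \<sigma>
  proof -
    have "peval \<sigma> Q * peval \<sigma> Q' = peval \<sigma> Q'"
      using arg_cong[OF Q(3), of "peval \<sigma>"] by (simp add: peval_mult bit_idem)
    moreover have "peval (\<sigma>(yi := b)) Q = peval \<sigma> Q" "peval (\<sigma>(yi := b)) Q' = peval \<sigma> Q'" for b
      using Q G by (auto intro!: peval_cong)
    ultimately show ?thesis
      unfolding u'_def path_at_simps path_at_sop_subst path t'(4) using G(4)
      by (cases "peval \<sigma> Q"; cases "peval \<sigma> Q'") auto
  qed
  have step: "TH_step u u'"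
    unfolding u'_def
  proof (rule TH_step.HHgen)
    show "phase u = Const (1/2) * Vr y0 * (Vr yi * hat Q + hat Q' + 1) + phase G"
      by (simp add: u_def P_def)
    show "y0 \<notin> Var Q \<union> Var Q' \<union> Var (phase G) \<union> Vars (outs u) \<union> Vars (ins u)"
      using VarG G Q by (auto simp: u_def)
  qed (use G Q in \<open>auto simp: u_def\<close>)
  have "TH_equiv n m t u"
    using t u path by (intro TH_equiv_path_at) (auto simp: u_def)
  moreover have "TH_equiv n m u u'" using u u' step by (intro TH_equiv_step) auto
  moreover have "TH_equiv n m u' t'"
    using t' u' path' G by (intro TH_equiv_path_at) (auto simp: u_def u'_def sop_subst_def)
  ultimately show ?thesis by (blast intro: TH_equiv_trans)
qed

lemma TH_equiv_Elim:
  assumes t': "t' \<in> SOP n m" "y \<notin> svars t'"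
    and t: "t \<in> SOP n m" "svars t = insert y (svars t')" "scal t' = 2 * scal t"
    and path: "\<And>\<sigma>. path_at t \<sigma> = path_at t' \<sigma>"
  shows "TH_equiv n m t t'"
proof -
  define u where "u = t'\<lparr>scal := scal t, svars := svars t\<rparr>"
  have "TH_step u (u\<lparr>scal := 2 * scal u, svars := svars u - {y}\<rparr>)"
    using t' t by (intro TH_step.Elim) (auto simp: u_def SOP_def)
  also have "u\<lparr>scal := 2 * scal u, svars := svars u - {y}\<rparr> = t'"
    using t' t by (simp add: u_def)
  finally have step: "TH_step u t'" .
  have u: "u \<in> SOP n m"
    using t t' by (auto simp: u_def SOP_def)
  have "TH_equiv n m t u"
    using t u path by (intro TH_equiv_path_at) (auto simp: u_def)
  moreover have "TH_equiv n m u t'" using u t' step by (intro TH_equiv_step) auto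
  ultimately show ?thesis by (rule TH_equiv_trans)
qed

section \<open>Permuting paths\<close>

lemma TH_equiv_HH:
  assumes G: "G \<in> SOP n m" "svars G = insert yi V" "yi \<notin> V" "y0 \<notin> insert yi V"
    and g: "Var g \<subseteq> V"
    and t: "t \<in> SOP n m" "svars t = insert y0 (insert yi V)"
      "\<And>\<sigma>. path_at t \<sigma> = twist (\<sigma> y0 = 1 \<and> \<sigma> yi \<noteq> peval \<sigma> g) (path_at G \<sigma>)"
    and t': "t' \<in> SOP n m" "scal t' = 2 * scal t" "svars t' = V"
      "\<And>\<sigma>. path_at t' \<sigma> = path_at G (\<sigma>(yi := peval \<sigma> g))"
  shows "TH_equiv n m t t'"
proof -
  define u where "u = t'\<lparr>scal := scal t, svars := insert y0 V\<rparr>"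
  have u: "u \<in> SOP n m" "path_at u \<sigma> = path_at t' \<sigma>" for \<sigma>
    using t' by (auto simp: u_def SOP_def)
  have g': "Var (1 + g) \<subseteq> V" using Var_add[of 1 g] g by auto
  have bits: "b * peval \<sigma> 1 + peval \<sigma> (1 + g) = 0 \<longleftrightarrow> b \<noteq> peval \<sigma> g"
    "1 + peval \<sigma> (1 + g) = peval \<sigma> g" for b \<sigma>
    by (cases b; cases "peval \<sigma> g"; simp)+
  have "TH_equiv n m t u"
  proof (rule TH_equiv_HHgen[where G = G and yi = yi and Q = 1 and Q' = "1 + g"])
    show "path_at t \<sigma> = twist (\<sigma> y0 = 1 \<and> \<sigma> yi * peval \<sigma> 1 + peval \<sigma> (1 + g) = 0) (path_at G \<sigma>)" for \<sigma>
      unfolding bits t(3) by (rule refl)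
    show "path_at u \<sigma> = twist (\<sigma> y0 = 1 \<and> peval \<sigma> 1 = 0) (path_at G (\<sigma>(yi := 1 + peval \<sigma> (1 + g))))" for \<sigma>
      unfolding bits u t'(4) by simp
  qed (use G t t' u g' in \<open>auto simp: u_def\<close>)
  moreover have "TH_equiv n m u t'"
    using G t' u by (intro TH_equiv_Elim[where y = y0]) (auto simp: u_def)
  ultimately show ?thesis by (rule TH_equiv_trans)
qed

text \<open>Introduce a copy \<open>x\<close> of the new value of \<open>y\<close> by a backward \<open>HH\<close> step, then solve the
  constraint for \<open>y\<close> instead of \<open>x\<close>.\<close>

lemma TH_equiv_shear:
  assumes t: "t \<in> SOP n m" "svars t = insert y V" "y \<notin> V" and g: "Var g \<subseteq> V"
    and t': "t' \<in> SOP n m" "svars t' = insert y V" "scal t' = scal t"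
      "\<And>\<sigma>. path_at t' \<sigma> = path_at t (\<sigma>(y := \<sigma> y + peval \<sigma> g))"
  shows "TH_equiv n m t t'"
proof -
  have fin: "finite V" using finite_svars[OF t(1)] t(2) by simp
  obtain x where x: "x \<notin> insert y V"
    using fin by (meson ex_new_if_finite finite.insertI infinite_UNIV_nat)
  obtain z where z: "z \<notin> insert x (insert y V)"
    using fin by (meson ex_new_if_finite finite.insertI infinite_UNIV_nat)
  have tcong: "path_at t \<sigma> = path_at t \<tau>" if "\<And>v. v \<in> insert y V \<Longrightarrow> \<sigma> v = \<tau> v" for \<sigma> \<tau>
    by (rule path_at_cong[OF t(1)], rule that) (simp add: t(2))
  have gcong: "peval \<sigma> g = peval \<tau> g" if "\<And>v. v \<in> V \<Longrightarrow> \<sigma> v = \<tau> v" for \<sigma> \<tau>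
    using g by (intro peval_cong that) auto
  define G where "G = t\<lparr>svars := insert x (insert y V)\<rparr>"
  have G: "G \<in> SOP n m" "svars G = insert x (insert y V)" "path_at G \<sigma> = path_at t \<sigma>" for \<sigma>
    using t by (auto simp: G_def SOP_def)
  \<comment> \<open>The sign variable \<open>z\<close> enforces \<open>x = y + g\<close>. Solving
    for \<open>x\<close> returns \<open>t\<close>; solving for \<open>y\<close> gives the path
    function \<open>H\<close>. Either solution doubles the scalar, hence the factor one half in
    \<open>u\<close>.\<close>
  define F where "F \<sigma> = twist (\<sigma> z = 1 \<and> \<sigma> x \<noteq> \<sigma> y + peval \<sigma> g) (path_at t \<sigma>)" for \<sigma>
  have F: "finite (insert z (insert x (insert y V)))" "wf_path n m (F \<sigma>)" for \<sigma>
    using fin wf_path_at[OF t(1)] by (auto simp: F_def)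
  have F_dep: "F \<sigma> = F \<tau>" if "\<And>v. v \<in> insert z (insert x (insert y V)) \<Longrightarrow> \<sigma> v = \<tau> v" for \<sigma> \<tau>
    using that tcong[of \<sigma> \<tau>] gcong[of \<sigma> \<tau>] by (simp add: F_def)
  obtain u where u: "u \<in> SOP n m" "scal u = scal t / 2" "svars u = insert z (insert x (insert y V))"
    "\<And>\<sigma>. path_at u \<sigma> = F \<sigma>"
    using sop_exists[where F = F and s = "scal t / 2", OF F F_dep] by blast
  define H where "H \<sigma> = path_at t (\<sigma>(y := \<sigma> x + peval \<sigma> g))" for \<sigma>
  have H: "finite (insert x V)" "wf_path n m (H \<sigma>)" for \<sigma>
    using fin wf_path_at[OF t(1)] by (auto simp: H_def)
  have H_dep: "H \<sigma> = H \<tau>" if "\<And>v. v \<in> insert x V \<Longrightarrow> \<sigma> v = \<tau> v" for \<sigma> \<tau>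
    unfolding H_def using that gcong[of \<sigma> \<tau>] by (intro tcong) auto
  obtain w where w: "w \<in> SOP n m" "scal w = scal t" "svars w = insert x V"
    "\<And>\<sigma>. path_at w \<sigma> = H \<sigma>"
    using sop_exists[where F = H and s = "scal t", OF H H_dep] by blast
  have Vars: "Var (Vr y + g) \<subseteq> insert y V" "Var (Vr x + g) \<subseteq> insert x V"
    using Var_add[of "Vr y" g] Var_add[of "Vr x" g] g by auto
  have "TH_equiv n m u t"
  proof (rule TH_equiv_HH[OF G(1,2) x z Vars(1) u(1,3)])
    show "path_at t \<sigma> = path_at G (\<sigma>(x := peval \<sigma> (Vr y + g)))" for \<sigma>
      unfolding G(3) using x by (intro tcong) auto
  qed (use u G t in \<open>auto simp: F_def\<close>)
  moreover have "TH_equiv n m u w"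
  proof (rule TH_equiv_HH[OF G(1) _ _ _ Vars(2) u(1)])
    have "a \<noteq> b + c \<longleftrightarrow> b \<noteq> a + c" for a b c :: bit
      by (cases a; cases b; cases c; simp)
    then show "path_at u \<sigma> = twist (\<sigma> z = 1 \<and> \<sigma> y \<noteq> peval \<sigma> (Vr x + g)) (path_at G \<sigma>)" for \<sigma>
      unfolding G(3) u(4) F_def peval_add peval_Vr by metis
  qed (use u G w x z t(3) in \<open>auto simp: insert_commute H_def\<close>)
  \<comment> \<open>Renaming \<open>x\<close> to \<open>y\<close> turns
    \<open>y \<leftarrow> x + g\<close> into the required
    \<open>y \<leftarrow> y + g\<close>.\<close>
  moreover have "TH_equiv n m w t'"
  proof (rule TH_equiv_step[OF w(1) t'(1)], rule disjI1, rule sop_identI)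
    show "bij_betw (id(x := y)) (svars w) (svars t')"
      using x t(3) by (auto simp: w t' bij_betw_def inj_on_def)
    show "path_at t' \<sigma> = path_at w (\<sigma> \<circ> id(x := y))" for \<sigma>
    proof -
      have "peval (\<sigma> \<circ> id(x := y)) g = peval \<sigma> g"
        using x by (intro gcong) auto
      then show ?thesis
        unfolding t'(4) w(4) H_def using x by (intro tcong) auto
    qed
  qed (use w t' in simp)
  ultimately show ?thesis
    by (blast intro: TH_equiv_trans TH_equiv_sym)
qed

text \<open>Quantifying over all pairs of morphisms, rather than fixing one, is what makes the
  property closed under composition.\<close>

definition admissible :: "nat \<Rightarrow> nat \<Rightarrow> nat set \<Rightarrow> ((nat \<Rightarrow> bit) \<Rightarrow> nat \<Rightarrow> bit) \<Rightarrow> bool" where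
  "admissible n m V p \<longleftrightarrow> (\<forall>t t'. t \<in> SOP n m \<longrightarrow> t' \<in> SOP n m \<longrightarrow> svars t = V \<longrightarrow> svars t' = V
     \<longrightarrow> scal t' = scal t \<longrightarrow> (\<forall>\<sigma>\<in>assignments V. path_at t' \<sigma> = path_at t (p \<sigma>)) \<longrightarrow> TH_equiv n m t t')"

lemma admissible_id: "admissible n m V id"
  unfolding admissible_def
proof (intro allI impI)
  fix t t' assume *: "t \<in> SOP n m" "t' \<in> SOP n m" "svars t = V" "svars t' = V" "scal t' = scal t"
    "\<forall>\<sigma>\<in>assignments V. path_at t' \<sigma> = path_at t (id \<sigma>)"
  have "path_at t' \<sigma> = path_at t \<sigma>" for \<sigma>
    using * path_at_restrict[OF *(1), of \<sigma>] path_at_restrict[OF *(2), of \<sigma>]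
    by (metis id_apply restrict_PiE_iff UNIV_I)
  then show "TH_equiv n m t t'" using * by (intro TH_equiv_path_at) auto
qed

lemma admissible_comp:
  assumes "finite V" "admissible n m V p" "admissible n m V q"
    and "p ` assignments V \<subseteq> assignments V" "q ` assignments V \<subseteq> assignments V"
  shows "admissible n m V (p \<circ> q)"
  unfolding admissible_def
proof (intro allI impI)
  fix t t' assume *: "t \<in> SOP n m" "t' \<in> SOP n m" "svars t = V" "svars t' = V" "scal t' = scal t"
    "\<forall>\<sigma>\<in>assignments V. path_at t' \<sigma> = path_at t ((p \<circ> q) \<sigma>)"
  obtain u where u: "u \<in> SOP n m" "scal u = scal t" "svars u = V"
    and path: "\<And>\<sigma>. \<sigma> \<in> assignments V \<Longrightarrow> path_at u \<sigma> = path_at t (p \<sigma>)"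
    using sop_exists_on[of V n m "\<lambda>\<sigma>. path_at t (p \<sigma>)" "scal t", OF assms(1) wf_path_at[OF *(1)]] by blast
  have "TH_equiv n m t u" using assms(2) u * path by (simp add: admissible_def)
  moreover have "TH_equiv n m u t'"
  proof -
    have "\<forall>\<sigma>\<in>assignments V. path_at t' \<sigma> = path_at u (q \<sigma>)"
    proof
      fix \<sigma> assume \<sigma>: "\<sigma> \<in> assignments V"
      then have "q \<sigma> \<in> assignments V" using assms(5) by blast
      then show "path_at t' \<sigma> = path_at u (q \<sigma>)" using \<sigma> *(6) path by simp
    qed
    then show ?thesis using assms(3) u * unfolding admissible_def by metis
  qed
  ultimately show "TH_equiv n m t t'" by (rule TH_equiv_trans)
qed

text \<open>Let \<open>g\<close> be the indicator, in the variables other than \<open>y\<close>, of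
  agreement with \<open>a\<close>. The shear by \<open>g\<close> flips \<open>y\<close> at
  \<open>a\<close> and at its neighbour only, and so exchanges these two points.\<close>

lemma admissible_transpose_adjacent:
  assumes V: "finite V" and a: "a \<in> assignments V" and y: "y \<in> V"
  shows "admissible n m V (Transposition.transpose a (a(y := a y + 1)))"
  unfolding admissible_def
proof (intro allI impI)
  fix t t' assume *: "t \<in> SOP n m" "t' \<in> SOP n m" "svars t = V" "svars t' = V" "scal t' = scal t"
    "\<forall>\<sigma>\<in>assignments V. path_at t' \<sigma> = path_at t (Transposition.transpose a (a(y := a y + 1)) \<sigma>)"
  have "\<exists>g. Var g \<subseteq> V - {y} \<and> (\<forall>\<sigma>. peval (lift \<sigma>) g = (of_bool (\<forall>v\<in>V - {y}. \<sigma> v = a v) :: bit))"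
    by (rule bpoly_exists) (use V in auto)
  then obtain g :: "bit bpoly" where g: "Var g \<subseteq> V - {y}"
    "\<And>\<sigma>. peval \<sigma> g = of_bool (\<forall>v\<in>V - {y}. \<sigma> v = a v)"
    by auto
  have trans: "Transposition.transpose a (a(y := a y + 1)) \<sigma> = \<sigma>(y := \<sigma> y + peval \<sigma> g)"
    if \<sigma>: "\<sigma> \<in> assignments V" for \<sigma>
  proof (cases "\<forall>v\<in>V - {y}. \<sigma> v = a v")
    case True
    have "\<sigma> v = a v" if "v \<noteq> y" for v
      using that True \<sigma> a by (cases "v \<in> V") (auto simp: PiE_def extensional_def)
    then have eq: "\<sigma> = a(y := \<sigma> y)" by auto
    have g1: "peval \<sigma> g = 1" using True by (simp add: g)
    show ?thesis
    proof (cases "\<sigma> y = a y")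
      case True
      then have "\<sigma> = a" using eq by (metis fun_upd_triv)
      then show ?thesis using g1 by simp
    next
      case False
      then have "\<sigma> y = a y + 1" by (cases "\<sigma> y"; cases "a y"; simp)
      moreover from this have "\<sigma> = a(y := a y + 1)" using eq by metis
      moreover have "a y + 1 + 1 = a y" by (cases "a y"; simp)
      ultimately show ?thesis using g1 by (metis fun_upd_triv fun_upd_upd transpose_apply_second)
    qed
  next
    case False
    then have "\<sigma> \<noteq> a" "\<sigma> \<noteq> a(y := a y + 1)" by auto
    moreover have "peval \<sigma> g = 0" using False by (simp add: g)
    ultimately show ?thesis by (simp del: add_bit_eq_xor)
  qed
  show "TH_equiv n m t t'"
  proof (rule TH_equiv_shear)
    show "Var g \<subseteq> V - {y}" by (rule g(1))
    show "path_at t' \<sigma> = path_at t (\<sigma>(y := \<sigma> y + peval \<sigma> g))" for \<sigma>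
    proof -
      let ?r = "restrict \<sigma> V"
      have "path_at t' \<sigma> = path_at t' ?r"
        using path_at_restrict[OF *(2)] * by metis
      also have "\<dots> = path_at t (?r(y := ?r y + peval ?r g))"
        using *(6) trans by simp
      also have "peval ?r g = peval \<sigma> g" using g(1) by (intro peval_cong) auto
      also have "path_at t (?r(y := ?r y + peval \<sigma> g)) = path_at t (\<sigma>(y := \<sigma> y + peval \<sigma> g))"
        using y * by (intro path_at_cong[OF *(1)]) auto
      finally show ?thesis .
    qed
  qed (use * y in auto)
qed

text \<open>Induction on the Hamming distance: with \<open>c\<close> the neighbour of
  \<open>a\<close> one step closer to \<open>b\<close>, conjugating the swap of \<open>c\<close> and
  \<open>b\<close> by that of \<open>a\<close> and \<open>c\<close> gives the swap of
  \<open>a\<close> and \<open>b\<close>.\<close>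

lemma admissible_transpose:
  assumes V: "finite V" and a: "a \<in> assignments V" and b: "b \<in> assignments V"
  shows "admissible n m V (Transposition.transpose a b)"
  using a
proof (induction "card {v\<in>V. a v \<noteq> b v}" arbitrary: a rule: less_induct)
  case less
  show ?case
  proof (cases "\<exists>y\<in>V. a y \<noteq> b y")
    case False
    then have "a = b" using less.prems b by (intro PiE_ext) auto
    then show ?thesis by (simp add: admissible_id)
  next
    case True
    then obtain y where y: "y \<in> V" "a y \<noteq> b y" by blast
    then have ay: "b y = a y + 1" by (cases "b y"; cases "a y"; simp)
    define c where "c = a(y := a y + 1)"
    have c: "c \<in> assignments V" using less.prems y by (auto simp: c_def PiE_def extensional_def)
    have "{v\<in>V. c v \<noteq> b v} \<subset> {v\<in>V. a v \<noteq> b v}"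
    proof (rule psubsetI)
      have c: "c v = (if v = y then b y else a v)" for v using ay by (simp add: c_def)
      show "{v\<in>V. c v \<noteq> b v} \<subseteq> {v\<in>V. a v \<noteq> b v}" by (auto simp: c)
      have "y \<in> {v\<in>V. a v \<noteq> b v}" "y \<notin> {v\<in>V. c v \<noteq> b v}" using y by (auto simp: c)
      then show "{v\<in>V. c v \<noteq> b v} \<noteq> {v\<in>V. a v \<noteq> b v}" by blast
    qed
    then have "card {v\<in>V. c v \<noteq> b v} < card {v\<in>V. a v \<noteq> b v}"
      using V by (intro psubset_card_mono) auto
    then have cb: "admissible n m V (Transposition.transpose c b)" using less.hyps c by blast
    have ac: "admissible n m V (Transposition.transpose a c)"
      unfolding c_def using V less.prems y by (intro admissible_transpose_adjacent)
    show ?thesis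
    proof (cases "c = b")
      case False
      have im: "Transposition.transpose d e ` assignments V \<subseteq> assignments V"
        if "d \<in> assignments V" "e \<in> assignments V" for d e
        using that by (simp add: transpose_image_eq)
      have "Transposition.transpose a b =
          Transposition.transpose a c \<circ> Transposition.transpose c b \<circ> Transposition.transpose a c"
        using False y by (intro transpose_comp_triple[symmetric]) auto
      moreover have "(Transposition.transpose a c \<circ> Transposition.transpose c b) ` assignments V \<subseteq> assignments V"
        unfolding image_comp[symmetric]
        by (rule subset_trans[OF image_mono[OF im[OF c b]] im[OF less.prems c]])
      then have "admissible n m V
          (Transposition.transpose a c \<circ> Transposition.transpose c b \<circ> Transposition.transpose a c)"
        by (rule admissible_comp[OF V admissible_comp[OF V ac cb im[OF less.prems c] im[OF c b]] ac _ im[OF less.prems c]])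
      ultimately show ?thesis by simp
    qed (use ac in simp)
  qed
qed

lemma admissible_permutes:
  assumes V: "finite V" and p: "p permutes assignments V"
  shows "admissible n m V p"
  using p finite_assignments[OF V]
proof (induction rule: permutes_induct)
  case (swap a b p)
  then show ?case
    using V by (intro admissible_comp admissible_transpose)
      (simp_all add: permutes_image transpose_image_eq)
qed (rule admissible_id)

lemma size_paths: "finite (svars t) \<Longrightarrow> size (paths t) = 2 ^ card (svars t)"
  by (simp add: paths_def card_PiE UNIV_bit numeral_2_eq_2)

text \<open>Equal multisets have equal size, hence the morphisms have equally many variables and can
  be renamed to share them. Two functions on the same assignments with the same image multiset
  differ by a permutation, which is admissible.\<close>

lemma TH_equiv_paths:
  assumes t: "t \<in> SOP n m" and t': "t' \<in> SOP n m" and s: "scal t' = scal t"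
    and paths: "paths t' = paths t"
  shows "TH_equiv n m t t'"
proof -
  have fin: "finite (svars t)" "finite (svars t')" using t t' by (auto simp: SOP_def)
  have "2 ^ card (svars t) = (2 ^ card (svars t') :: nat)"
    using size_paths[OF fin(1)] size_paths[OF fin(2)] paths by simp
  then have "card (svars t) = card (svars t')" by simp
  then obtain f where f: "bij_betw f (svars t) (svars t')"
    using fin finite_same_card_bij by blast
  have dep: "path_at t (\<sigma> \<circ> f) = path_at t (\<tau> \<circ> f)" if "\<And>v. v \<in> svars t' \<Longrightarrow> \<sigma> v = \<tau> v" for \<sigma> \<tau>
    using that f by (intro path_at_cong[OF t]) (auto simp: bij_betw_def)
  obtain u where u: "u \<in> SOP n m" "scal u = scal t" "svars u = svars t'"
    "\<And>\<sigma>. path_at u \<sigma> = path_at t (\<sigma> \<circ> f)"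
    using sop_exists[where F = "\<lambda>\<sigma>. path_at t (\<sigma> \<circ> f)" and s = "scal t", OF fin(2) wf_path_at[OF t] dep] by blast
  have ident: "sop_ident t u"
    using f u by (intro sop_identI[where f = f]) auto
  have "image_mset (path_at t') (mset_set (assignments (svars t')))
      = image_mset (path_at u) (mset_set (assignments (svars t')))"
    using paths_sop_ident[OF t ident] paths u(3) by (simp add: paths_def)
  then obtain p where p: "p permutes assignments (svars t')"
    "\<forall>\<sigma>\<in>assignments (svars t'). path_at t' \<sigma> = path_at u (p \<sigma>)"
    using image_mset_eq_implies_permutes[OF finite_assignments[OF fin(2)]] by metis
  have "TH_equiv n m u t'"
    using admissible_permutes[OF fin(2) p(1)] u t' s p(2) by (simp add: admissible_def)
  then show ?thesis
    using TH_equiv_step[OF t u(1)] ident by (blast intro: TH_equiv_trans)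
qed

lemma paths_insert:
  assumes "finite V" "y \<notin> V" "svars t = insert y V"
  shows "paths t = image_mset (\<lambda>\<sigma>. path_at t (\<sigma>(y := 0))) (mset_set (assignments V))
    + image_mset (\<lambda>\<sigma>. path_at t (\<sigma>(y := 1))) (mset_set (assignments V))"
  by (simp add: paths_def assms mset_assignments_insert image_mset.compositionality comp_def)

lemma TH_equiv_double:
  assumes t: "t \<in> SOP n m" and t': "t' \<in> SOP n m" and s: "scal t' = 2 * scal t"
    and paths: "paths t = paths t' + paths t'"
  shows "TH_equiv n m t t'"
proof -
  have fin: "finite (svars t')" using t' by (rule finite_svars)
  obtain y where y: "y \<notin> svars t'"
    using ex_new_if_finite[OF infinite_UNIV_nat fin] by blast
  define u where "u = t'\<lparr>scal := scal t, svars := insert y (svars t')\<rparr>"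
  have u: "u \<in> SOP n m" using t' by (auto simp: u_def SOP_def)
  have upd: "path_at t' (\<sigma>(y := b)) = path_at t' \<sigma>" for \<sigma> b
    using y by (intro path_at_cong[OF t']) auto
  have "paths u = paths t' + paths t'"
    using fin y by (subst paths_insert[where V = "svars t'" and y = y]) (auto simp: u_def upd paths_def)
  then have "TH_equiv n m t u"
    using t u paths by (intro TH_equiv_paths) (auto simp: u_def)
  moreover have "TH_equiv n m u t'"
    using t' u y s by (intro TH_equiv_Elim[where y = y]) (auto simp: u_def)
  ultimately show ?thesis by (rule TH_equiv_trans)
qed

section \<open>Realising a multiset of paths by a morphism\<close>

lemma mset_indexing:
  assumes "finite S" "size M = card S"
  obtains f where "image_mset f (mset_set S) = M"
proof -
  have "\<exists>f. image_mset f (mset_set S) = M"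
    using assms
  proof (induction S arbitrary: M rule: finite_induct)
    case (insert x S)
    then obtain a N where N: "M = add_mset a N" by (metis card.insert size_eq_Suc_imp_eq_union)
    then obtain f where f: "image_mset f (mset_set S) = N" using insert by auto
    have "image_mset (f(x := a)) (mset_set S) = image_mset f (mset_set S)"
      using insert by (intro image_mset_cong) auto
    then have "image_mset (f(x := a)) (mset_set (insert x S)) = M" using insert N f by simp
    then show ?case by blast
  qed simp
  then show thesis using that by blast
qed

lemma sop_of_mset:
  assumes "size M = 2 ^ k" "\<And>e. e \<in># M \<Longrightarrow> wf_path n m e"
  obtains t where "t \<in> SOP n m" "scal t = s" "paths t = M" "card (svars t) = k"
proof -
  have card: "card (assignments {..<k}) = 2 ^ k" by (simp add: card_PiE UNIV_bit numeral_2_eq_2)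
  obtain f where f: "image_mset f (mset_set (assignments {..<k})) = M"
    using mset_indexing[of "assignments {..<k}" M] assms(1) card by auto
  have wf: "wf_path n m (f \<sigma>)" if "\<sigma> \<in> assignments {..<k}" for \<sigma>
    using that by (intro assms(2)) (simp flip: f)
  obtain t where t: "t \<in> SOP n m" "scal t = s" "svars t = {..<k}"
    "\<And>\<sigma>. \<sigma> \<in> assignments {..<k} \<Longrightarrow> path_at t \<sigma> = f \<sigma>"
    using sop_exists_on[of "{..<k}" n m f s, OF _ wf] by blast
  have "paths t = M"
    unfolding paths_def f[symmetric] t(3) by (intro image_mset_cong) (simp add: t(4))
  then show thesis using that t by simp
qed

section \<open>Integer relations between roots of unity\<close>

text \<open>Squaring is additive modulo 2, so \<open>x * x + 1\<close> is congruent to the square of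
  \<open>x + 1\<close>; iterate from \<open>X + 1\<close>, which is congruent to
  \<open>X - 1\<close>.\<close>

lemma power_two_shift_mod_2:
  "\<exists>r :: int poly. monom 1 (2 ^ j) + 1 = [:-1, 1:] ^ (2 ^ j) + 2 * r"
proof (induction j)
  case 0
  have "monom 1 1 + 1 = [:-1, 1:] + 2 * (1 :: int poly)"
    by (simp add: monom_altdef numeral_poly one_pCons)
  then show ?case by (intro exI[of _ 1]) simp
next
  case (Suc j)
  then obtain r :: "int poly" where r: "monom 1 (2 ^ j) + 1 = [:-1, 1:] ^ (2 ^ j) + 2 * r" by blast
  define x y :: "int poly" where "x = monom 1 (2 ^ j)" and "y = [:-1, 1:] ^ (2 ^ j)"
  have x: "x = y + 2 * r - 1" using r by (simp add: x_def y_def algebra_simps)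
  have "x * x + 1 = y * y + 2 * (2 * r * y + 2 * r * r - 2 * r - y + 1)"
    unfolding x by (simp add: algebra_simps)
  moreover have "monom 1 (2 ^ Suc j) = x * x" by (simp add: x_def mult_monom mult_2)
  moreover have "[:-1, 1:] ^ (2 ^ Suc j) = y * y" by (simp add: y_def power_add[symmetric] mult_2)
  ultimately show ?case by metis
qed

lemma dvd_2_poly_iff: "2 dvd (p :: int poly) \<longleftrightarrow> (\<forall>i. even (coeff p i))"
  using const_poly_dvd_iff[of "2 :: int" p] by (simp add: numeral_poly)

lemma prime_elem_2_poly: "prime_elem (2 :: int poly)"
  using lift_prime_elem_poly[of "2 :: int"] by (simp add: numeral_poly)

text \<open>Modulo 2 the only prime factor of \<open>g * h\<close> is \<open>X - 1\<close>, so a nonconstant \<open>g\<close> vanishes at 1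
  modulo 2; the factors \<open>X - 1\<close> are cancelled from \<open>h\<close> one at a time.\<close>

lemma odd_factor_of_shift_power:
  fixes g h r :: "int poly"
  assumes "g * h = [:-1, 1:] ^ N + 2 * r" "degree g + degree h = N" "degree g \<ge> 1"
    and "odd (lead_coeff h)" "odd (poly g 1)"
  shows False
  using assms
proof (induction "degree h" arbitrary: h N r)
  case 0
  then obtain c where h: "h = [:c:]" by (metis degree_eq_zeroE)
  \<comment> \<open>Here \<open>N = degree g\<close> is positive, so the right side is even, while
    \<open>g\<close> is odd at 1 and the constant \<open>h\<close> is odd.\<close>
  have "poly g 1 * poly h 1 = poly ([:-1, 1:] ^ N + 2 * r) 1"
    unfolding 0(2)[symmetric] by simp
  then have "even (poly g 1 * c)" using 0 h by (simp add: zero_power)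
  then show False using 0 h by simp
next
  case (Suc d)
  \<comment> \<open>The remainder of \<open>h\<close> on division by \<open>X - 1\<close> is its
    value at 1. It turns out even, so modulo 2 one factor \<open>X - 1\<close> splits off.\<close>
  define h' where "h' = synthetic_div h 1"
  have h: "h = [:-1, 1:] * h' + [:poly h 1:]"
    using synthetic_div_correct'[of 1 h] by (simp add: h'_def)
  obtain M where M: "N = Suc M" using Suc by (cases N) auto
  have "poly g 1 * poly h 1 = poly ([:-1, 1:] ^ N + 2 * r) 1"
    unfolding Suc(3)[symmetric] by simp
  then have "even (poly g 1 * poly h 1)" by (simp add: M)
  then have "even (poly h 1)" using Suc.prems by simp
  then obtain c where c: "poly h 1 = 2 * c" by blast
  have deg: "degree h' = d" using Suc(2) by (simp add: h'_def degree_synthetic_div)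
  have const: "[:poly h 1:] = 2 * [:c:]" by (simp add: c numeral_poly)
  have "g * h = [:-1, 1:] * (g * h') + 2 * (g * [:c:])"
    by (subst h, subst const) (simp only: algebra_simps)
  then have "[:-1, 1:] * (g * h' - [:-1, 1:] ^ M) = 2 * (r - g * [:c:])"
    using Suc(3) by (simp only: M power_Suc algebra_simps)
  \<comment> \<open>Cancelling \<open>X - 1\<close> modulo 2 is possible because 2 is prime among
    integer polynomials and does not divide \<open>X - 1\<close>.\<close>
  then have "2 dvd [:-1, 1:] * (g * h' - [:-1, 1:] ^ M)" by (rule dvdI)
  moreover have "\<not> 2 dvd [:-1, 1 :: int:]"
    unfolding dvd_2_poly_iff by (auto intro!: exI[of _ 0])
  ultimately have "2 dvd g * h' - [:-1, 1:] ^ M"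
    using prime_elem_2_poly prime_elem_dvd_mult_iff by blast
  then obtain r' where "g * h' - [:-1, 1:] ^ M = 2 * r'" by blast
  then have "g * h' = [:-1, 1:] ^ M + 2 * r'" by (simp add: algebra_simps)
  moreover have "lead_coeff h' = lead_coeff h"
  proof -
    have "coeff h (Suc d) = coeff ([:-1, 1:] * h') (Suc d) + coeff [:poly h 1:] (Suc d)"
      using h by (metis coeff_add)
    also have "\<dots> = coeff h' d - coeff h' (Suc d)" by simp
    also have "coeff h' (Suc d) = 0" by (rule coeff_eq_0) (simp add: deg)
    finally show ?thesis using deg Suc(2) by simp
  qed
  ultimately show False
    using Suc.hyps(1)[of h' M r'] Suc.prems Suc(2) M deg by simp
qed

section \<open>Integer polynomials evaluated at a root of \<open>X^N + 1\<close>\<close>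

definition int_poly_eval :: "complex \<Rightarrow> int poly \<Rightarrow> complex" where
  "int_poly_eval z p = poly (map_poly of_int p) z"

lemma int_poly_eval_0 [simp]: "int_poly_eval z 0 = 0"
  by (simp add: int_poly_eval_def)

lemma int_poly_eval_pCons [simp]: "int_poly_eval z (pCons a p) = of_int a + z * int_poly_eval z p"
  by (simp add: int_poly_eval_def map_poly_pCons)

lemma int_poly_eval_add: "int_poly_eval z (p + q) = int_poly_eval z p + int_poly_eval z q"
  by (induction p q rule: poly_induct2) (simp_all add: algebra_simps)

lemma int_poly_eval_smult: "int_poly_eval z (smult c p) = of_int c * int_poly_eval z p"
  by (induction p) (simp_all add: algebra_simps)

lemma int_poly_eval_mult: "int_poly_eval z (p * q) = int_poly_eval z p * int_poly_eval z q"
  by (induction p) (simp_all add: int_poly_eval_add int_poly_eval_smult algebra_simps)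

lemma int_poly_eval_monom: "int_poly_eval z (monom a i) = of_int a * z ^ i"
  by (induction i) (simp_all add: monom_0 monom_Suc algebra_simps)

lemma int_poly_eval_sum: "int_poly_eval z (sum f A) = (\<Sum>x\<in>A. int_poly_eval z (f x))"
  by (induction A rule: infinite_finite_induct) (simp_all add: int_poly_eval_add)

text \<open>Irreducibility of \<open>X\<^sup>N + 1\<close> for a power \<open>N\<close> of two: in a nontrivial factorisation one factor
  would be odd at 1, because the values multiply to 2.\<close>

lemma two_power_cyclotomic_minimal:
  assumes root: "\<omega> ^ (2 ^ j) = -1" and "f \<noteq> 0" "degree f < 2 ^ j"
  shows "int_poly_eval \<omega> f \<noteq> 0"
proof
  assume "int_poly_eval \<omega> f = 0"
  define N :: nat where "N = 2 ^ j"
  define F :: "int poly" where "F = monom 1 N + 1"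
  define good where "good p \<longleftrightarrow> p \<noteq> 0 \<and> int_poly_eval \<omega> p = 0" for p
  have good_f: "good f" using assms \<open>int_poly_eval \<omega> f = 0\<close> by (simp add: good_def)
  \<comment> \<open>An integer polynomial of least degree vanishing at \<omega>; its primitive part
    \<open>g\<close> plays the role of the minimal polynomial.\<close>
  obtain g0 where g0: "good g0" "\<And>p. good p \<Longrightarrow> degree g0 \<le> degree p"
    using ex_has_least_nat[of good f degree] good_f by blast
  define g where "g = primitive_part g0"
  have cg: "content g0 \<noteq> 0" using g0 by (simp add: good_def)
  have g0_eq: "g0 = smult (content g0) g" by (simp add: g_def)
  have "int_poly_eval \<omega> g0 = of_int (content g0) * int_poly_eval \<omega> g"
    by (subst g0_eq) (rule int_poly_eval_smult)
  then have good_g: "good g" using g0 cg unfolding good_def g_def by auto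
  have deg_g: "degree g = degree g0" by (simp add: g_def)
  have content_g: "content g = 1" using g0 by (simp add: g_def good_def)
  have min: "degree g \<le> degree p" if "good p" for p using g0(2)[OF that] deg_g by simp
  have F0: "int_poly_eval \<omega> F = 0"
    using root by (simp add: F_def N_def int_poly_eval_add int_poly_eval_monom one_pCons)
  \<comment> \<open>Division over the integers costs a constant factor \<open>c\<close>. The
    remainder vanishes at \<omega> and has smaller degree than \<open>g\<close>, so minimality makes
    it zero.\<close>
  obtain q r where qr: "pseudo_divmod F g = (q, r)" by (cases "pseudo_divmod F g")
  define c where "c = coeff g (degree g) ^ (Suc (degree F) - degree g)"
  have g_ne: "g \<noteq> 0" using good_g by (simp add: good_def)
  have c: "c \<noteq> 0" using g_ne by (simp add: c_def)
  have div: "smult c F = g * q + r" and r: "r = 0 \<or> degree r < degree g"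
    using pseudo_divmod[OF g_ne qr] by (simp_all add: c_def)
  have "int_poly_eval \<omega> (smult c F) = int_poly_eval \<omega> (g * q + r)" using div by simp
  then have "int_poly_eval \<omega> r = 0"
    using F0 good_g by (simp add: int_poly_eval_smult int_poly_eval_add int_poly_eval_mult good_def)
  then have r0: "r = 0" using r min[of r] unfolding good_def by force
  have N: "N > 0" by (simp add: N_def)
  have degF: "degree F = N" unfolding F_def using N
    by (subst degree_add_eq_left) (simp_all add: degree_monom_eq)
  have leadF: "coeff F N = 1" using N by (simp add: F_def)
  have contF: "content F = 1"
    using content_dvd_coeff[of F N] leadF by (metis is_unit_content_iff)
  \<comment> \<open>Gauss's lemma: \<open>F\<close> and \<open>g\<close> have content 1, so
    \<open>c\<close> divides \<open>q\<close> and cancels, leaving a factorisation of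
    \<open>F\<close> itself.\<close>
  have "content (smult c F) = content q"
    unfolding div r0 using content_g by (simp add: content_mult)
  then have "content q = \<bar>c\<bar>" using contF by simp
  then have "q = smult \<bar>c\<bar> (primitive_part q)" by (metis content_times_primitive_part)
  then have "smult c F = smult \<bar>c\<bar> (g * primitive_part q)"
    using div r0 by (metis add.right_neutral mult_smult_right)
  moreover have "\<bar>c\<bar> = c * sgn c" by (simp add: abs_sgn)
  ultimately have "smult c F = smult c (g * smult (sgn c) (primitive_part q))"
    by (simp add: mult_smult_right)
  then obtain h where h: "F = g * h" using c by (metis smult_cancel)
  have F_ne: "F \<noteq> 0" using leadF by auto
  have deg: "degree g + degree h = N"
    using h degF F_ne g_ne by (metis degree_mult_eq mult_zero_right)
  have "degree g \<ge> 1"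
  proof (rule ccontr)
    assume "\<not> degree g \<ge> 1"
    then obtain a where "g = [:a:]" by (metis One_nat_def Suc_leI degree_eq_zeroE neq0_conv)
    then show False using good_g by (simp add: good_def)
  qed
  moreover have "degree h \<ge> 1"
    \<comment> \<open>The assumed \<open>f\<close> has degree below \<open>N\<close> and bounds the
      degree of \<open>g\<close>, so \<open>h\<close> is not constant.\<close>
    using deg min[OF good_f] assms(3) by (simp add: N_def)
  moreover have "lead_coeff g * lead_coeff h = 1"
    using leadF degF h by (metis lead_coeff_mult)
  then have "odd (lead_coeff g)" "odd (lead_coeff h)"
    by (metis even_mult_iff odd_one)+
  moreover obtain R where R: "F = [:-1, 1:] ^ N + 2 * R"
    using power_two_shift_mod_2[of j] by (auto simp: F_def N_def)
  moreover have "odd (poly g 1) \<or> odd (poly h 1)"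
  proof (rule ccontr)
    assume "\<not> ?thesis"
    then have "4 dvd poly g 1 * poly h 1" by (auto elim!: evenE)
    moreover have "poly g 1 * poly h 1 = 2"
      using h by (metis F_def poly_mult poly_add poly_monom poly_1 power_one mult_1 one_add_one)
    ultimately show False by simp
  qed
  ultimately show False
    using odd_factor_of_shift_power[of g h N R] odd_factor_of_shift_power[of h g N R] h deg
    by (auto simp: mult.commute add.commute)
qed

text \<open>List the roots as powers of \<omega> with \<open>\<omega> ^ N = -1\<close> and pair the
  exponents \<open>i\<close> and \<open>i + N\<close>. The relation becomes a polynomial of degree
  below \<open>N\<close> vanishing at \<omega>, whose coefficients are the differences
  \<open>h c - h (- c)\<close>.\<close>

lemma roots_of_unity_relation:
  fixes h :: "complex \<Rightarrow> int"
  assumes sum0: "(\<Sum>c | c ^ (2 ^ Suc j) = 1. of_int (h c) * c) = 0" and c: "c ^ (2 ^ Suc j) = 1"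
  shows "h c = h (- c)"
proof -
  define N :: nat where "N = 2 ^ j"
  define \<omega> where "\<omega> = cis (pi / N)"
  have N: "N > 0" by (simp add: N_def)
  have \<omega>N: "\<omega> ^ N = -1" using N by (simp add: \<omega>_def Complex.DeMoivre)
  have \<omega>: "cis (2 * pi * real i / real (2 ^ Suc j)) = \<omega> ^ i" for i
    by (simp add: \<omega>_def Complex.DeMoivre N_def field_simps)
  have bij: "bij_betw (\<lambda>i. \<omega> ^ i) {..<2 ^ Suc j} {c. c ^ (2 ^ Suc j) = 1}"
    using Complex.bij_betw_roots_unity[of "2 ^ Suc j"] unfolding \<omega> by simp
  have 2: "{..<2 ^ Suc j} = {..<N} \<union> (\<lambda>i. i + N) ` {..<N}"
  proof (intro set_eqI iffI)
    fix i :: nat assume i: "i \<in> {..<2 ^ Suc j}"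
    show "i \<in> {..<N} \<union> (\<lambda>i. i + N) ` {..<N}"
    proof (cases "i < N")
      case False
      then have "i = (i - N) + N" "i - N \<in> {..<N}" using i by (auto simp: N_def)
      then show ?thesis by blast
    qed simp
  qed (auto simp: N_def)
  define a where "a i = h (\<omega> ^ i) - h (- (\<omega> ^ i))" for i
  have "0 = (\<Sum>i<2 ^ Suc j. of_int (h (\<omega> ^ i)) * \<omega> ^ i)"
    using sum.reindex_bij_betw[OF bij, of "\<lambda>c. of_int (h c) * c"] sum0 by simp
  also have "\<dots> = (\<Sum>i<N. of_int (h (\<omega> ^ i)) * \<omega> ^ i) + (\<Sum>i<N. of_int (h (\<omega> ^ (i + N))) * \<omega> ^ (i + N))"
    unfolding 2 by (subst sum.union_disjoint) (auto simp: sum.reindex)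
  also have "\<dots> = (\<Sum>i<N. of_int (a i) * \<omega> ^ i)"
    by (simp add: power_add \<omega>N a_def algebra_simps sum_subtractf sum_negf)
  also have "\<dots> = int_poly_eval \<omega> (\<Sum>i<N. monom (a i) i)"
    by (simp add: int_poly_eval_sum int_poly_eval_monom)
  finally have zero: "int_poly_eval \<omega> (\<Sum>i<N. monom (a i) i) = 0" by simp
  have "degree (\<Sum>i<N. monom (a i) i) < N"
    using N by (intro degree_sum_less) (auto intro: le_less_trans[OF degree_monom_le])
  then have "(\<Sum>i<N. monom (a i) i) = 0"
    using two_power_cyclotomic_minimal[of \<omega> j] \<omega>N zero unfolding N_def by blast
  then have coeff0: "coeff (\<Sum>i<N. monom (a i) i) i = 0" for i by simp
  have a0: "a i = 0" if "i < N" for i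
    using coeff0[of i] that by (simp add: coeff_sum)
  obtain i where i: "i < 2 ^ Suc j" "c = \<omega> ^ i"
    using bij c unfolding bij_betw_def by (metis (mono_tags, lifting) imageE lessThan_iff mem_Collect_eq)
  show ?thesis
  proof (cases "i < N")
    case True
    then show ?thesis using a0[of i] i by (simp add: a_def)
  next
    case False
    then have "c = - (\<omega> ^ (i - N))"
      using i \<omega>N by (metis le_add_diff_inverse2 mult_minus1_right not_le power_add)
    moreover have "i - N < N" using i False by (simp add: N_def)
    ultimately show ?thesis using a0[of "i - N"] by (simp add: a_def)
  qed
qed

section \<open>Exchanging cancelling pairs\<close>

abbreviation balanced :: "path multiset \<Rightarrow> path multiset" where
  "balanced A \<equiv> A + image_mset neg A"

text \<open>Use \<open>HHgen\<close> with \<open>Q' = 0\<close>. The variables below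
  \<open>k\<close> index the paths, variable \<open>k\<close> is the \<open>yi\<close> that selects
  \<open>B\<close> or \<open>C + A\<close>, and variable \<open>Suc k\<close> is the sign variable
  \<open>y0\<close>. With \<open>Q\<close> the indicator of \<open>C\<close>, the sign spares
  \<open>C\<close> exactly where \<open>yi = 1\<close>, and setting \<open>yi\<close> to 1 drops
  \<open>balanced B\<close>.\<close>

lemma TH_equiv_cancel:
  assumes size: "size C + size A = 2 ^ k" "size B = 2 ^ k"
    and wf: "\<And>e. e \<in># C + A + B \<Longrightarrow> wf_path n m e"
    and t: "t \<in> SOP n m" "paths t = C + C + balanced A + balanced B"
    and t': "t' \<in> SOP n m" "paths t' = C + C + balanced A" "scal t' = scal t"
  shows "TH_equiv n m t t'"
proof -
  define V where "V = {..<k}"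
  \<comment> \<open>The tag records whether a path comes from \<open>C\<close> or from
    \<open>A\<close>, which may have paths in common; \<open>Q\<close> is the polynomial of this
    tag.\<close>
  define X where "X = image_mset (Pair True) C + image_mset (Pair False) A"
  have V: "finite V" "k \<notin> V" "Suc k \<notin> insert k V" by (auto simp: V_def)
  have card: "card (assignments V) = 2 ^ k" by (simp add: V_def card_PiE UNIV_bit numeral_2_eq_2)
  obtain f where f: "image_mset f (mset_set (assignments V)) = X"
    using mset_indexing[of "assignments V" X] size card V by (auto simp: X_def)
  obtain b where b: "image_mset b (mset_set (assignments V)) = B"
    using mset_indexing[of "assignments V" B] size card V by auto
  let ?r = "\<lambda>\<sigma>. restrict \<sigma> V"
  have r: "?r \<sigma> \<in> assignments V" for \<sigma> by simp
  have wf_b: "wf_path n m (b (?r \<sigma>))" for \<sigma>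
  proof -
    have "b (?r \<sigma>) \<in># B" unfolding b[symmetric] using r V by simp
    then show ?thesis by (intro wf) simp
  qed
  have wf_f: "wf_path n m (snd (f (?r \<sigma>)))" for \<sigma>
  proof -
    have "f (?r \<sigma>) \<in># X" unfolding f[symmetric] using r V by simp
    then have "snd (f (?r \<sigma>)) \<in># C + A" by (auto simp: X_def)
    then show ?thesis by (intro wf) auto
  qed
  have r_cong: "?r \<sigma> = ?r \<tau>" if "\<And>v. v \<in> V \<Longrightarrow> \<sigma> v = \<tau> v" for \<sigma> \<tau>
    using that by auto
  have "\<exists>Q. Var Q \<subseteq> V \<and> (\<forall>\<sigma>. peval (lift \<sigma>) Q = (of_bool (fst (f (?r \<sigma>))) :: bit))"
    using V(1) by (rule bpoly_exists) (metis r_cong)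
  then obtain Q :: "bit bpoly" where Q: "Var Q \<subseteq> V" "\<And>\<sigma>. peval \<sigma> Q = of_bool (fst (f (?r \<sigma>)))"
    by auto
  define F where "F \<sigma> = (if \<sigma> k = 1 then snd (f (?r \<sigma>)) else b (?r \<sigma>))" for \<sigma>
  have F_dep: "F \<sigma> = F \<tau>" if "\<And>v. v \<in> insert k V \<Longrightarrow> \<sigma> v = \<tau> v" for \<sigma> \<tau>
    using r_cong[of \<sigma> \<tau>] that by (simp add: F_def)
  have F: "finite (insert k V)" "wf_path n m (F \<sigma>)" for \<sigma>
    using V wf_b wf_f by (auto simp: F_def)
  obtain G where G: "G \<in> SOP n m" "svars G = insert k V" "\<And>\<sigma>. path_at G \<sigma> = F \<sigma>"
    using sop_exists[where F = F, OF F F_dep] by blast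
  define U where "U \<sigma> = twist (\<sigma> (Suc k) = 1 \<and> \<sigma> k * peval \<sigma> Q + peval \<sigma> 0 = 0) (F \<sigma>)" for \<sigma>
  define U' where "U' \<sigma> = twist (\<sigma> (Suc k) = 1 \<and> peval \<sigma> Q = 0) (F (\<sigma>(k := 1 + peval \<sigma> 0)))" for \<sigma>
  have U_dep: "U \<sigma> = U \<tau>" if "\<And>v. v \<in> insert (Suc k) (insert k V) \<Longrightarrow> \<sigma> v = \<tau> v" for \<sigma> \<tau>
    using r_cong[of \<sigma> \<tau>] F_dep[of \<sigma> \<tau>] that by (simp add: U_def Q)
  have U'_dep: "U' \<sigma> = U' \<tau>" if "\<And>v. v \<in> insert (Suc k) V \<Longrightarrow> \<sigma> v = \<tau> v" for \<sigma> \<tau>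
  proof -
    have "F (\<sigma>(k := 1)) = F (\<tau>(k := 1))" using that by (intro F_dep) auto
    then show ?thesis using r_cong[of \<sigma> \<tau>] that by (simp add: U'_def Q)
  qed
  have wf_U: "wf_path n m (U \<sigma>)" "wf_path n m (U' \<sigma>)" for \<sigma>
    using wf_b wf_f by (auto simp: U_def U'_def F_def)
  have fin: "finite (insert (Suc k) (insert k V))" "finite (insert (Suc k) V)" using V by auto
  obtain u where u: "u \<in> SOP n m" "scal u = scal t" "svars u = insert (Suc k) (insert k V)"
    "\<And>\<sigma>. path_at u \<sigma> = U \<sigma>"
    using sop_exists[where F = U and s = "scal t", OF fin(1) wf_U(1) U_dep] by blast
  obtain u' where u': "u' \<in> SOP n m" "scal u' = scal t" "svars u' = insert (Suc k) V"
    "\<And>\<sigma>. path_at u' \<sigma> = U' \<sigma>"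
    using sop_exists[where F = U' and s = "scal t", OF fin(2) wf_U(2) U'_dep] by blast
  have "TH_equiv n m u u'"
  proof (rule TH_equiv_HHgen[where Q' = 0, OF G(1,2) V(2,3) Q(1) _ _ u(1,2,3) _ u'(1,2,3)])
    show "path_at u \<sigma> = twist (\<sigma> (Suc k) = 1 \<and> \<sigma> k * peval \<sigma> Q + peval \<sigma> 0 = 0) (path_at G \<sigma>)" for \<sigma>
      unfolding u(4) U_def G(3) by (rule refl)
    show "path_at u' \<sigma> = twist (\<sigma> (Suc k) = 1 \<and> peval \<sigma> Q = 0) (path_at G (\<sigma>(k := 1 + peval \<sigma> 0)))" for \<sigma>
      unfolding u'(4) U'_def G(3) by (rule refl)
  qed simp_all
  moreover have r_upd: "?r (\<sigma>(k := c, Suc k := d)) = \<sigma>" "?r (\<sigma>(Suc k := d)) = \<sigma>" "?r (\<sigma>(k := c)) = \<sigma>"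
    "?r (\<sigma>(Suc k := d, k := c)) = \<sigma>"
    if "\<sigma> \<in> assignments V" for \<sigma> c d
  proof -
    have "?r \<sigma> = \<sigma>" using that by (rule PiE_restrict)
    moreover have "?r (\<sigma>(k := c, Suc k := d)) = ?r \<sigma>" "?r (\<sigma>(Suc k := d)) = ?r \<sigma>" "?r (\<sigma>(k := c)) = ?r \<sigma>"
      "?r (\<sigma>(Suc k := d, k := c)) = ?r \<sigma>"
      using V by (intro r_cong; auto)+
    ultimately show "?r (\<sigma>(k := c, Suc k := d)) = \<sigma>" "?r (\<sigma>(Suc k := d)) = \<sigma>" "?r (\<sigma>(k := c)) = \<sigma>"
      "?r (\<sigma>(Suc k := d, k := c)) = \<sigma>" by metis+
  qed
  let ?I = "\<lambda>h. image_mset h (mset_set (assignments V))"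
  have paths_u: "paths u = ?I b + ?I (neg \<circ> b) + (?I (snd \<circ> f) + ?I (\<lambda>\<sigma>. twist (\<not> fst (f \<sigma>)) (snd (f \<sigma>))))"
  proof -
    have "?I (\<lambda>\<sigma>. U (\<sigma>(k := 0, Suc k := 0))) = ?I b"
      "?I (\<lambda>\<sigma>. U (\<sigma>(k := 0, Suc k := 1))) = ?I (neg \<circ> b)"
      "?I (\<lambda>\<sigma>. U (\<sigma>(k := 1, Suc k := 0))) = ?I (snd \<circ> f)"
      "?I (\<lambda>\<sigma>. U (\<sigma>(k := 1, Suc k := 1))) = ?I (\<lambda>\<sigma>. twist (\<not> fst (f \<sigma>)) (snd (f \<sigma>)))"
      using V(1) by (intro image_mset_cong; simp add: U_def F_def Q r_upd)+
    then show ?thesis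
      using V by (subst paths_insert[OF _ V(3) u(3)])
        (simp_all add: u(4) mset_assignments_insert image_mset.compositionality comp_def add_ac)
  qed
  have paths_u': "paths u' = ?I (snd \<circ> f) + ?I (\<lambda>\<sigma>. twist (\<not> fst (f \<sigma>)) (snd (f \<sigma>)))"
  proof -
    have "?I (\<lambda>\<sigma>. U' (\<sigma>(Suc k := 0))) = ?I (snd \<circ> f)"
      "?I (\<lambda>\<sigma>. U' (\<sigma>(Suc k := 1))) = ?I (\<lambda>\<sigma>. twist (\<not> fst (f \<sigma>)) (snd (f \<sigma>)))"
      using V(1) by (intro image_mset_cong; simp add: U'_def F_def Q r_upd)+
    then show ?thesis
      using V by (subst paths_insert[OF _ _ u'(3)]) (simp_all add: u'(4))
  qed
  have f_snd: "?I (snd \<circ> f) = C + A"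
    unfolding image_mset.compositionality[symmetric] f by (simp add: X_def image_mset.compositionality comp_def)
  have "?I (\<lambda>\<sigma>. twist (\<not> fst (f \<sigma>)) (snd (f \<sigma>))) = image_mset (\<lambda>x. twist (\<not> fst x) (snd x)) X"
    unfolding f[symmetric] by (simp add: image_mset.compositionality comp_def)
  then have f_twist: "?I (\<lambda>\<sigma>. twist (\<not> fst (f \<sigma>)) (snd (f \<sigma>))) = C + image_mset neg A"
    by (simp add: X_def image_mset.compositionality comp_def)
  have b_neg: "?I (neg \<circ> b) = image_mset neg B"
    unfolding image_mset.compositionality[symmetric] b by (rule refl)
  have "TH_equiv n m t u"
    using t u by (intro TH_equiv_paths) (simp_all add: paths_u f_snd f_twist b b_neg add_ac)
  moreover have "TH_equiv n m u' t'"
    using t' u' by (intro TH_equiv_paths) (simp_all add: paths_u' f_snd f_twist add_ac)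
  ultimately show ?thesis using TH_equiv_trans by blast
qed

lemma wf_paths: "t \<in> SOP n m \<Longrightarrow> e \<in># paths t \<Longrightarrow> wf_path n m e"
  by (auto simp: paths_def wf_path_at finite_svars)

text \<open>Both sides are obtained by cancelling one half of the balanced part from
  \<open>2N + 2(E + -E) + 2(E' + -E') + (N + -N)\<close>.\<close>

lemma TH_equiv_exchange:
  assumes t: "t \<in> SOP n m" "paths t = N + balanced E"
    and t': "t' \<in> SOP n m" "paths t' = N + balanced E'"
    and s: "scal t' = scal t" and size: "size E' = size E"
  shows "TH_equiv n m t t'"
proof -
  define k where "k = card (svars t)"
  have k: "size N + size (E + E) = 2 ^ k" "size N + size (E' + E') = 2 ^ k"
    using size_paths[OF finite_svars[OF t(1)]] t(2) size by (simp_all add: k_def)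
  have wfN: "wf_path n m e" if "e \<in># N + E + E'" for e
  proof -
    have "e \<in># paths t \<or> e \<in># paths t'" using that by (auto simp: t t')
    then show ?thesis using wf_paths[OF t(1)] wf_paths[OF t'(1)] by blast
  qed
  obtain v where v: "v \<in> SOP n m" "scal v = scal t / 2" "paths v = paths t + paths t"
    by (rule sop_of_mset[of "paths t + paths t" "Suc k" n m "scal t / 2"])
      (use wf_paths[OF t(1)] size_paths[OF finite_svars[OF t(1)]] in \<open>auto simp: k_def\<close>)
  obtain v' where v': "v' \<in> SOP n m" "scal v' = scal t / 2" "paths v' = paths t' + paths t'"
    by (rule sop_of_mset[of "paths t' + paths t'" "Suc k" n m "scal t / 2"])
      (use wf_paths[OF t'(1)] k in \<open>auto simp: t'(2)\<close>)
  \<comment> \<open>Each of \<open>N + (E + E)\<close>, \<open>E' + E' + N\<close> and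
    \<open>E + E + N\<close> has size \<open>2 ^ k\<close>, as cancelling requires. The term
    \<open>balanced N\<close> fills both cancelled parts up to this size, and it makes
    \<open>M\<close> symmetric in \<open>E\<close> and \<open>E'\<close>.\<close>
  define M where "M = N + N + balanced (E + E) + balanced (E' + E' + N)"
  have "size M = 2 ^ (k + 2)"
    using k size by (simp add: M_def)
  moreover have "wf_path n m e" if "e \<in># M" for e
    using that by (auto simp: M_def wfN)
  ultimately obtain w where w: "w \<in> SOP n m" "scal w = scal t / 2" "paths w = M"
    using sop_of_mset by metis
  have "TH_equiv n m w v"
    using k w v by (intro TH_equiv_cancel[of N "E + E" k "E' + E' + N"]) (auto simp: M_def t add_ac intro!: wfN)
  moreover have "TH_equiv n m w v'"
    using k w v' by (intro TH_equiv_cancel[of N "E' + E'" k "E + E + N"]) (auto simp: M_def t' add_ac intro!: wfN)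
  moreover have "TH_equiv n m v t" "TH_equiv n m v' t'"
    using v v' t t' s by (auto intro!: TH_equiv_double)
  ultimately show ?thesis by (meson TH_equiv_trans TH_equiv_sym)
qed

section \<open>Adjusting the scalar and the number of variables\<close>

lemma TH_equiv_pad_Elim:
  assumes "t \<in> SOP n m"
  obtains t' where "t' \<in> SOP n m" "TH_equiv n m t t'" "scal t' = scal t / 2"
    "card (svars t') = card (svars t) + 1" "set_mset (paths t') = set_mset (paths t)"
proof (rule sop_of_mset)
  show "size (paths t + paths t) = 2 ^ (card (svars t) + 1)"
    using size_paths[OF finite_svars[OF assms]] by simp
  show "wf_path n m e" if "e \<in># paths t + paths t" for e
    using that wf_paths[OF assms] by auto
  fix t' assume t': "t' \<in> SOP n m" "scal t' = scal t / 2" "paths t' = paths t + paths t"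
    "card (svars t') = card (svars t) + 1"
  then have "TH_equiv n m t t'"
    using assms by (intro TH_equiv_sym[OF TH_equiv_double]) auto
  with t' show thesis by (intro that[of t']) auto
qed

text \<open>Halving the scalar costs two variables here, against one in
  \<open>TH_equiv_pad_Elim\<close>; the two costs together allow scalar and variable count to be
  aligned independently. The proof doubles the paths and then cancels backwards with
  \<open>C\<close> and \<open>B\<close> both equal to the given paths and \<open>A\<close>
  empty.\<close>

lemma TH_equiv_pad_HH:
  assumes "t \<in> SOP n m"
  obtains t' where "t' \<in> SOP n m" "TH_equiv n m t t'" "scal t' = scal t / 2"
    "card (svars t') = card (svars t) + 2" "set_mset (paths t') = set_mset (balanced (paths t))"
proof -
  let ?M = "paths t" and ?k = "card (svars t)"
  note size = size_paths[OF finite_svars[OF assms]]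
  obtain u where u: "u \<in> SOP n m" "scal u = scal t / 2" "paths u = ?M + ?M"
    by (rule sop_of_mset[of "?M + ?M" "Suc ?k" n m "scal t / 2"]) (use wf_paths[OF assms] size in auto)
  obtain w where w: "w \<in> SOP n m" "scal w = scal t / 2" "paths w = ?M + ?M + balanced ?M" "card (svars w) = ?k + 2"
    by (rule sop_of_mset[of "?M + ?M + balanced ?M" "?k + 2" n m "scal t / 2"]) (use wf_paths[OF assms] size in auto)
  have "TH_equiv n m u t"
    using u assms by (intro TH_equiv_double) auto
  moreover have "TH_equiv n m w u"
    using u w size wf_paths[OF assms] by (intro TH_equiv_cancel[of ?M "{#}" ?k ?M]) auto
  ultimately have "TH_equiv n m t w" by (meson TH_equiv_trans TH_equiv_sym)
  with w show thesis by (intro that[of w]) auto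
qed

definition root_paths :: "nat \<Rightarrow> sop \<Rightarrow> bool" where
  "root_paths d t \<longleftrightarrow> (\<forall>e \<in># paths t. fst e ^ (2 ^ Suc d) = 1)"

lemma TH_equiv_pad:
  assumes "t \<in> SOP n m" "root_paths d t"
  shows "\<exists>t'. t' \<in> SOP n m \<and> TH_equiv n m t t' \<and> scal t' = scal t / 2 ^ (a + r)
    \<and> card (svars t') = card (svars t) + a + 2 * r \<and> root_paths d t'"
proof (induction r)
  case 0
  show ?case
  proof (induction a)
    case (Suc a)
    then obtain u where u: "u \<in> SOP n m" "TH_equiv n m t u" "scal u = scal t / 2 ^ a"
      "card (svars u) = card (svars t) + a" "root_paths d u" by auto
    obtain t' where "t' \<in> SOP n m" "TH_equiv n m u t'" "scal t' = scal u / 2"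
      "card (svars t') = card (svars u) + 1" "set_mset (paths t') = set_mset (paths u)"
      using TH_equiv_pad_Elim[OF u(1)] by metis
    then show ?case using u by (intro exI[of _ t']) (auto simp: root_paths_def intro: TH_equiv_trans)
  qed (use assms in auto)
next
  case (Suc r)
  then obtain u where u: "u \<in> SOP n m" "TH_equiv n m t u" "scal u = scal t / 2 ^ (a + r)"
    "card (svars u) = card (svars t) + a + 2 * r" "root_paths d u" by auto
  obtain t' where t': "t' \<in> SOP n m" "TH_equiv n m u t'" "scal t' = scal u / 2"
    "card (svars t') = card (svars u) + 2" "set_mset (paths t') = set_mset (balanced (paths u))"
    using TH_equiv_pad_HH[OF u(1)] by metis
  have "root_paths d t'"
    unfolding root_paths_def t'(5) using u(5) by (auto simp: root_paths_def neg_def)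
  then show ?case using u t' by (intro exI[of _ t']) (auto intro: TH_equiv_trans)
qed

section \<open>Reduced parts and completeness\<close>

lemma balanced_decomposition:
  assumes "\<And>e. e \<in># M \<Longrightarrow> fst e \<noteq> 0"
  shows "\<exists>N E. M = N + balanced E \<and> (\<forall>e \<in># N. neg e \<notin># N)"
  using assms
proof (induction "size M" arbitrary: M rule: less_induct)
  case less
  show ?case
  proof (cases "\<forall>e \<in># M. neg e \<notin># M")
    case False
    then obtain e where e: "e \<in># M" "neg e \<in># M" by blast
    \<comment> \<open>A nonzero phase differs from its negative, so the two occurrences are distinct
      and can be removed together.\<close>
    have "neg e \<noteq> e" using less.prems[OF e(1)] by (cases e) (auto simp: neg_def)
    then obtain M' where M: "M = add_mset e (add_mset (neg e) M')"
      using e by (metis insert_noteq_member multi_member_split)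
    obtain N E where "M' = N + balanced E" "\<forall>e \<in># N. neg e \<notin># N"
      using less.hyps[of M'] less.prems by (auto simp: M)
    then show ?thesis
      by (intro exI[of _ N] exI[of _ "add_mset e E"]) (auto simp: M)
  qed (intro exI[of _ M] exI[of _ "{#}"], simp)
qed

lemma sum_mset_weight:
  assumes "finite U" "\<And>e. e \<in># N \<Longrightarrow> fst e \<in> U"
  shows "(\<Sum>e\<in>#N. weight x x' e) = (\<Sum>c\<in>U. of_nat (count N (c, x, x')) * c)"
  using assms(2)
proof (induction N)
  case (add e N)
  obtain c u v where e: "e = (c, u, v)" by (metis prod_cases3)
  have "(\<Sum>c'\<in>U. of_nat (count (add_mset e N) (c', x, x')) * c')
      = (\<Sum>c'\<in>U. of_nat (count N (c', x, x')) * c' + (if c' = c then weight x x' e else 0))"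
    by (intro sum.cong) (auto simp: e weight_def algebra_simps)
  also have "\<dots> = (\<Sum>c'\<in>U. of_nat (count N (c', x, x')) * c') + weight x x' e"
    using assms(1) add.prems[of e] by (simp add: sum.distrib e)
  finally show ?case using add by simp
qed simp

text \<open>For fixed bit strings the differences of multiplicities form an integer relation between
  roots of unity, hence agree at \<open>e\<close> and \<open>neg e\<close>. In each multiset one of
  these two multiplicities is zero, and then the equality of differences forces both differences to
  vanish.\<close>

lemma reduced_mset_eqI:
  assumes red: "\<forall>e \<in># N. neg e \<notin># N" "\<forall>e \<in># N'. neg e \<notin># N'"
    and root: "\<And>e. e \<in># N + N' \<Longrightarrow> fst e ^ (2 ^ Suc d) = 1"
    and sum: "\<And>x x'. (\<Sum>e\<in>#N. weight x x' e) = (\<Sum>e\<in>#N'. weight x x' e)"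
  shows "N = N'"
proof -
  define U where "U = {c :: complex. c ^ (2 ^ Suc d) = 1}"
  have U: "finite U" unfolding U_def by (intro finite_roots_unity) simp
  have diff: "int (count N e) - int (count N' e) = int (count N (neg e)) - int (count N' (neg e))" for e
  proof -
    obtain c u v where e: "e = (c, u, v)" by (metis prod_cases3)
    define h where "h c = int (count N (c, u, v)) - int (count N' (c, u, v))" for c
    have "(\<Sum>c\<in>U. of_int (h c) * c) = (\<Sum>e\<in>#N. weight u v e) - (\<Sum>e\<in>#N'. weight u v e)"
      using root by (subst (1 2) sum_mset_weight[OF U])
        (auto simp: U_def h_def algebra_simps sum_subtractf)
    then have "(\<Sum>c | c ^ (2 ^ Suc d) = 1. of_int (h c) * c) = 0"
      using sum by (simp add: U_def)
    note rel = roots_of_unity_relation[OF this]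
    show ?thesis
    proof (cases "c \<in> U")
      case True
      then show ?thesis using rel[of c] by (simp add: U_def e neg_def h_def)
    next
      \<comment> \<open>Outside the roots of unity neither \<open>e\<close> nor \<open>neg e\<close>
        occurs, since the order is even.\<close>
      case False
      have "(- c) ^ (2 ^ Suc d) = c ^ (2 ^ Suc d)" by (simp add: power_minus_even)
      then have "e \<notin># N + N'" "neg e \<notin># N + N'"
        using False root[of e] root[of "neg e"] unfolding U_def e neg_def by auto
      then have "count N e = 0" "count N' e = 0" "count N (neg e) = 0" "count N' (neg e) = 0"
        by (simp_all add: count_eq_zero_iff)
      then show ?thesis by (simp only:)
    qed
  qed
  have red': "count N e = 0 \<or> count N (neg e) = 0" "count N' e = 0 \<or> count N' (neg e) = 0" for e
    using red by (auto simp: count_eq_zero_iff)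
  show ?thesis
  proof (rule multiset_eqI)
    fix e show "count N e = count N' e"
      using diff[of e] red'[of e] by auto
  qed
qed

lemma root_paths_dyadic:
  assumes "t \<in> dyadic_SOP (Suc d) n m"
  shows "root_paths d t"
proof -
  obtain P where P: "int_coeffs P" "phase t = Const (1 / 2 ^ Suc d) * P"
    using assms by (auto simp: dyadic_SOP_def)
  have "fst (path_at t \<sigma>) ^ (2 ^ Suc d) = 1" for \<sigma>
  proof -
    obtain z where z: "peval (lift \<sigma>) P = of_int z"
      using int_coeffsD[OF P(1), of \<sigma>] by (auto elim: Ints_cases)
    have "fst (path_at t \<sigma>) ^ (2 ^ Suc d)
        = exp (of_nat (2 ^ Suc d) * (2 * \<i> * complex_of_real pi * complex_of_real (1 / 2 ^ Suc d * of_int z)))"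
      by (simp only: path_at_def fst_conv P(2) peval_mult[OF lift_idem] peval_Const z exp_of_nat_mult)
    also have "\<dots> = exp (2 * \<i> * complex_of_real pi * complex_of_real (of_int z))"
      by (simp add: field_simps)
    also have "\<dots> = exp (2 * \<i> * complex_of_real pi * complex_of_real 0)"
      unfolding exp_2pi_eq_iff by simp
    finally show ?thesis by simp
  qed
  then show ?thesis by (auto simp: root_paths_def paths_def)
qed

text \<open>Split off the cancelling pairs on both sides. They contribute nothing to the
  interpretation and the scalar is nonzero, so the reduced parts coincide. Equal variable counts
  then leave equally many pairs, which can be exchanged.\<close>

lemma TH_equiv_complete_aligned:
  assumes t: "t \<in> SOP n m" "root_paths d t" and t': "t' \<in> SOP n m" "root_paths d t'"
    and s: "scal t' = scal t" "scal t \<noteq> 0" and card: "card (svars t') = card (svars t)"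
    and interp: "interp t = interp t'"
  shows "TH_equiv n m t t'"
proof -
  have nz: "fst e \<noteq> 0" if "u \<in> SOP n m" "e \<in># paths u" for u e
    using wf_paths[OF that] by (auto simp: wf_path_def)
  obtain N E where N: "paths t = N + balanced E" "\<forall>e \<in># N. neg e \<notin># N"
    using balanced_decomposition[of "paths t"] nz[OF t(1)] by blast
  obtain N' E' where N': "paths t' = N' + balanced E'" "\<forall>e \<in># N'. neg e \<notin># N'"
    using balanced_decomposition[of "paths t'"] nz[OF t'(1)] by blast
  have bal: "(\<Sum>e\<in>#balanced X. weight x x' e) = 0" for X x x'
    by (induction X) auto
  have "N = N'"
  proof (rule reduced_mset_eqI[OF N(2) N'(2)])
    show "fst e ^ (2 ^ Suc d) = 1" if "e \<in># N + N'" for e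
    proof -
      have "e \<in># paths t \<or> e \<in># paths t'" using that by (auto simp: N N')
      then show ?thesis using t t' unfolding root_paths_def by blast
    qed
    show "(\<Sum>e\<in>#N. weight x x' e) = (\<Sum>e\<in>#N'. weight x x' e)" for x x'
    proof -
      have "(\<Sum>e\<in>#paths t. weight x x' e) = (\<Sum>e\<in>#paths t'. weight x x' e)"
        using fun_cong[OF fun_cong[OF interp], of x x'] s unfolding interp_paths weight_def by simp
      then show ?thesis using bal[of x x' E] bal[of x x' E'] by (simp add: N N' add.assoc)
    qed
  qed
  moreover have "size (paths t) = size (paths t')"
    using card t t' by (simp add: size_paths finite_svars)
  ultimately have "size E' = size E" by (simp add: N N')
  with \<open>N = N'\<close> show ?thesis
    using t t' s N N' by (intro TH_equiv_exchange[of t n m N E t' E']) auto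
qed

theorem theorem6p9:
  fixes k n m :: nat and t1 t2 :: sop
  assumes "k \<ge> 1"
    and "t1 \<in> dyadic_SOP (k + 1) n m" and "t2 \<in> dyadic_SOP (k + 1) n m"
  shows "interp t1 = interp t2 \<longleftrightarrow> TH_equiv n m t1 t2"
proof
  assume interp: "interp t1 = interp t2"
  have SOP: "t1 \<in> SOP n m" "t2 \<in> SOP n m" and root: "root_paths k t1" "root_paths k t2"
    using assms(2,3) root_paths_dyadic[of _ k n m] by (auto simp: dyadic_SOP_def)
  obtain p1 p2 :: int where p: "scal t1 = 1 / 2 powi p1" "scal t2 = 1 / 2 powi p2"
    using assms(2,3) by (auto simp: dyadic_SOP_def)
  \<comment> \<open>With \<open>a\<close> padding steps of the first kind and \<open>r\<close> of
    the second, the scalar exponent grows by \<open>a + r\<close> and the variable count by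
    \<open>a + 2 * r\<close>. The net numbers of steps on the first side must solve
    \<open>a + r = P\<close> and \<open>a + 2 * r = K\<close>, so \<open>a = 2 * P - K\<close> and
    \<open>r = K - P\<close>; negative amounts are moved to the second side.\<close>
  define P K where "P = p2 - p1" and "K = int (card (svars t2)) - int (card (svars t1))"
  obtain u1 where u1: "u1 \<in> SOP n m" "TH_equiv n m t1 u1" "scal u1 = scal t1 / 2 ^ (nat (2 * P - K) + nat (K - P))"
    "card (svars u1) = card (svars t1) + nat (2 * P - K) + 2 * nat (K - P)" "root_paths k u1"
    using TH_equiv_pad[OF SOP(1) root(1)] by blast
  obtain u2 where u2: "u2 \<in> SOP n m" "TH_equiv n m t2 u2" "scal u2 = scal t2 / 2 ^ (nat (K - 2 * P) + nat (P - K))"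
    "card (svars u2) = card (svars t2) + nat (K - 2 * P) + 2 * nat (P - K)" "root_paths k u2"
    using TH_equiv_pad[OF SOP(2) root(2)] by blast
  have "card (svars u2) = card (svars u1)"
    unfolding u1 u2 K_def by linarith
  moreover have pow: "1 / 2 powi p / 2 ^ j = (1 / 2 powi (p + int j) :: real)" for p j
    by (simp add: power_int_add)
  have scal: "scal u1 = 1 / 2 powi (p1 + int (nat (2 * P - K) + nat (K - P)))"
    "scal u2 = 1 / 2 powi (p2 + int (nat (K - 2 * P) + nat (P - K)))"
    unfolding u1 u2 p by (rule pow)+
  moreover have "p1 + int (nat (2 * P - K) + nat (K - P)) = p2 + int (nat (K - 2 * P) + nat (P - K))"
  proof -
    \<comment> \<open>Splitting an integer into positive and negative parts removes the truncation
      in \<open>nat\<close> from the comparison of exponents.\<close>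
    have nat: "int (nat x) = x + int (nat (- x))" for x by simp
    have "p1 + ((2 * P - K + x) + (K - P + y)) = p2 + (x + y)" for x y
      by (simp add: P_def)
    then show ?thesis
      by (simp only: of_nat_add nat[of "2 * P - K"] nat[of "K - P"] minus_diff_eq)
  qed
  then have "scal u2 = scal u1" unfolding scal by simp
  moreover have "interp u1 = interp u2"
    using interp TH_equiv_sound[OF u1(2)] TH_equiv_sound[OF u2(2)] by simp
  ultimately have "TH_equiv n m u1 u2"
    using u1 u2 by (intro TH_equiv_complete_aligned[where d = k]) auto
  then show "TH_equiv n m t1 t2"
    using u1(2) u2(2) by (meson TH_equiv_trans TH_equiv_sym)
qed (rule TH_equiv_sound)

end
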